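(* Let $B(u)$ be the generating matrix of the reflection algebra $\mathcal B(n,l)$. For any $\sigma\in S_n$ consider the decomposition $\sigma=\Gamma_1\cdots\Gamma_s$ into nonintersecting cycles (fixed points counted as cycles of length one), let $g_i$ be the maximal element of the cycle $\Gamma_i$, and let $G_\sigma=\{g_i\}_{i=1}^s$. Then $$\langle\langle B_1,\dots,B_n\rangle\rangle=\sum_{\sigma\in S_n}\bar\alpha(\sigma)\,\sigma^{-1}\,B_{\sigma^{[1]}(1)}(u)\,B_{\sigma^{[2]}(2)}(u-1)\cdots B_{\sigma^{[n]}(n)}(u-n+1),$$ where $$\bar\alpha(\sigma)=\prod_{g\in\{1,\dots,n\}\setminus G_\sigma}\frac{1}{n-2u-2+g},$$ the permutation $\sigma^{[i]}$ is the word restriction of $\sigma$ on the set $\{i,\dots,n\}$, and $\sigma^{-1}$ is identified with the corresponding operator acting on $(\mathbb C^n)^{\otimes n}$.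
   Context: Reflection algebra. Let $n=m+l$ with $m,l$ nonnegative integers, and $\varepsilon_i=1$ for $1\le i\le m$, $\varepsilon_i=-1$ for $m<i\le n$. Let $P:v\otimes w\mapsto w\otimes v$ on $\mathbb C^n\otimes\mathbb C^n$ and $R(u)=1-P/u$. The reflection algebra $\mathcal B(n,l)$ is the unital associative algebra over $\mathbb C$ with generators $b_{ij}^{(r)}$ ($i,j=1,\dots,n$, $r=0,1,2,\dots$), $b_{ij}^{(0)}=\delta_{ij}\varepsilon_i$, collected into series $b_i^j(u)=\sum_{r\ge0}b_{ij}^{(r)}u^{-r}$ and the matrix $B(u)=\sum_{i,j}E_{ij}\otimes b_i^j(u)\in\operatorname{End}\mathbb C^n\otimes\mathcal B(n,l)[[u^{-1}]]$, subject to the reflection equation $R(u-v)B_1(u)R(u+v)B_2(v)=B_2(v)R(u+v)B_1(u)R(u-v)$ and the unitary condition $B(u)B(-u)=1$. For a matrix $X=(x_{ij})$ over an associative algebra $A$, $X_s=\sum_{i,j}1\otimes\cdots\otimes E_{ij}\otimes\cdots\otimes1\otimes x_{ij}\in\operatorname{End}(\mathbb C^n)^{\otimes n}\otimes A$ with $E_{ij}$ in the $s$-th position; $P_{ij}$ denotes $P$ acting on the $i$-th and $j$-th copies of $\mathbb C^n$ in $(\mathbb C^n)^{\otimes n}$. The symmetric group $S_n$ acts on $(\mathbb C^n)^{\otimes n}$ by permuting tensor factors, the transposition $(i,j)$ acting as $P_{ij}$ (a product of transpositions acts as the product of the corresponding operators in the same order). Products of permutations are composed from right to left, and the cycle $(a_1,\dots,a_r)$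 sends $a_1\mapsto a_2\mapsto\cdots\mapsto a_r\mapsto a_1$. Shifted series and rational functions of $u$ are expanded as power series in $u^{-1}$. For $k=1,\dots,n$ put $\Pi_k=1-(2u-k-n+2)^{-1}\sum_{i=k+1}^nP_{ki}$, and $$\langle\langle B_1,\dots,B_n\rangle\rangle=B_1(u)\Pi_1B_2(u-1)\Pi_2\cdots B_{n-1}(u-n+2)\Pi_{n-1}B_n(u-n+1).$$ Word restriction. Let $\sigma=\Gamma_1\cdots\Gamma_s$ be the decomposition of a permutation of $\{1,\dots,n\}$ into nonintersecting cycles and $G\subset\{1,\dots,n\}$. The word restriction $\Gamma|_G$ of a cycle $\Gamma$ is obtained by deleting from the word of the cycle all elements not belonging to $G$ (it is empty if $\Gamma$ contains no elements of $G$). The word restriction of $\sigma$ on $G$ is $\sigma|_G=\Gamma_1|_G\cdots\Gamma_s|_G$. For example, the word restriction of $(1,5,7,3)(4)(6,2)$ on $\{1,2,3\}$ is $(1,3)(2)$. *)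

theory Defs
  imports
    "HOL-Computational_Algebra.Formal_Laurent_Series"
    "HOL-Combinatorics.Cycles"
    "HOL-Library.FuncSet"
    "HOL-Library.Poly_Mapping"
    "HOL-Library.Type_Length"
begin

unbundle fps_syntax

section \<open>Operators on tensor powers\<close>

text \<open>
  An element of \<open>End(C^n)^{\<otimes>N} \<otimes> A\<close> is its matrix of coefficients in \<open>A\<close>: rows and columns are
  indexed by the multi-indices \<open>{1..N} \<rightarrow> {1..n}\<close>, which label the basis vectors
  \<open>e_{a 1} \<otimes> \<dots> \<otimes> e_{a N}\<close>. All operators below vanish outside this index set, so that
  equality of operators is equality of functions.
\<close>

type_synonym 'a tensor_op = "(nat \<Rightarrow> nat) \<Rightarrow> (nat \<Rightarrow> nat) \<Rightarrow> 'a"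

definition multi_idx :: "nat \<Rightarrow> nat \<Rightarrow> (nat \<Rightarrow> nat) set"
  where "multi_idx n N = {1..N} \<rightarrow>\<^sub>E {1..n}"

definition op_one :: "nat \<Rightarrow> nat \<Rightarrow> 'a::semiring_1 tensor_op"
  where "op_one n N = (\<lambda>a b. if a \<in> multi_idx n N \<and> a = b then 1 else 0)"

definition op_mult :: "nat \<Rightarrow> nat \<Rightarrow> 'a::semiring_1 tensor_op \<Rightarrow> 'a tensor_op \<Rightarrow> 'a tensor_op"
  where "op_mult n N X Y = (\<lambda>a b. \<Sum>c\<in>multi_idx n N. X a c * Y c b)"

definition op_prod :: "nat \<Rightarrow> nat \<Rightarrow> 'a::semiring_1 tensor_op list \<Rightarrow> 'a tensor_op"
  where "op_prod n N Xs = foldr (op_mult n N) Xs (op_one n N)"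

text \<open>
  The operator \<open>X_s\<close>: since \<open>1 \<otimes> \<dots> \<otimes> E_{ij} \<otimes> \<dots> \<otimes> 1\<close> has entry 1 at \<open>(a, b)\<close> iff \<open>a s = i\<close>,
  \<open>b s = j\<close> and \<open>a\<close>, \<open>b\<close> agree off \<open>s\<close>, the sum over \<open>i, j\<close> leaves the entry \<open>x_{a s, b s}\<close>.
\<close>

definition leg :: "nat \<Rightarrow> nat \<Rightarrow> nat \<Rightarrow> (nat \<Rightarrow> nat \<Rightarrow> 'a::semiring_1) \<Rightarrow> 'a tensor_op"
  where "leg n N s X = (\<lambda>a b.
    if a \<in> multi_idx n N \<and> b \<in> multi_idx n N \<and> (\<forall>t\<in>{1..N} - {s}. a t = b t)
    then X (a s) (b s) else 0)"

text \<open>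
  The action of \<open>\<sigma>\<close> puts the \<open>i\<close>-th tensor factor into position \<open>\<sigma> i\<close>. It is multiplicative for
  right-to-left composition (lemma \<open>perm_op_comp\<close>), and a transposition swaps two factors.
\<close>

definition perm_op :: "nat \<Rightarrow> nat \<Rightarrow> (nat \<Rightarrow> nat) \<Rightarrow> 'a::semiring_1 tensor_op"
  where "perm_op n N \<sigma> = (\<lambda>a b.
    if a \<in> multi_idx n N \<and> b \<in> multi_idx n N \<and> (\<forall>i\<in>{1..N}. a (\<sigma> i) = b i) then 1 else 0)"

abbreviation swap_op :: "nat \<Rightarrow> nat \<Rightarrow> nat \<Rightarrow> nat \<Rightarrow> 'a::semiring_1 tensor_op"
  where "swap_op n N i j \<equiv> perm_op n N (transpose i j)"

lemma finite_multi_idx [simp]: "finite (multi_idx n N)"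
  by (simp add: multi_idx_def finite_PiE)

lemma perm_op_comp:
  assumes "\<sigma> permutes {1..N}" "\<tau> permutes {1..N}"
  shows "op_mult n N (perm_op n N \<sigma>) (perm_op n N \<tau>) = (perm_op n N (\<sigma> \<circ> \<tau>) :: 'a::semiring_1 tensor_op)"
proof (intro ext)
  fix a b :: "nat \<Rightarrow> nat"
  show "op_mult n N (perm_op n N \<sigma>) (perm_op n N \<tau>) a b = (perm_op n N (\<sigma> \<circ> \<tau>) a b :: 'a)"
  proof (cases "a \<in> multi_idx n N")
    case True
    define c where "c = restrict (\<lambda>i. a (\<sigma> i)) {1..N}"
    have \<sigma>_in: "\<sigma> i \<in> {1..N}" if "i \<in> {1..N}" for i
      using permutes_in_image[OF assms(1)] that by blast
    have \<tau>_in: "\<tau> i \<in> {1..N}" if "i \<in> {1..N}" for i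
      using permutes_in_image[OF assms(2)] that by blast
    have a_in: "a i \<in> {1..n}" if "i \<in> {1..N}" for i
      using True that unfolding multi_idx_def by (rule PiE_mem)
    have c_in: "c \<in> multi_idx n N"
      unfolding multi_idx_def c_def by (rule restrict_PiE_iff[THEN iffD2]) (blast intro: a_in \<sigma>_in)
    have c_iff: "(\<forall>i\<in>{1..N}. a (\<sigma> i) = d i) \<longleftrightarrow> d = c" if "d \<in> multi_idx n N" for d
    proof
      assume *: "\<forall>i\<in>{1..N}. a (\<sigma> i) = d i"
      show "d = c"
        by (rule PiE_ext[OF that[unfolded multi_idx_def] c_in[unfolded multi_idx_def]])
           (use * in \<open>simp add: c_def\<close>)
    qed (simp add: c_def)
    have "op_mult n N (perm_op n N \<sigma>) (perm_op n N \<tau>) a b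
        = (\<Sum>d\<in>multi_idx n N. if d = c then perm_op n N \<tau> c b else (0::'a))"
      unfolding op_mult_def
    proof (rule sum.cong)
      fix d assume "d \<in> multi_idx n N"
      then show "perm_op n N \<sigma> a d * perm_op n N \<tau> d b = (if d = c then perm_op n N \<tau> c b else (0::'a))"
        using True c_in c_iff[of d] by (auto simp: perm_op_def)
    qed simp
    also have "\<dots> = perm_op n N \<tau> c b"
      using c_in by simp
    also have "(\<forall>i\<in>{1..N}. c (\<tau> i) = b i) \<longleftrightarrow> (\<forall>i\<in>{1..N}. a (\<sigma> (\<tau> i)) = b i)"
      by (intro ball_cong refl) (use \<tau>_in in \<open>simp add: c_def\<close>)
    then have "perm_op n N \<tau> c b = (perm_op n N (\<sigma> \<circ> \<tau>) a b :: 'a)"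
      using True c_in unfolding perm_op_def comp_apply by simp
    finally show ?thesis .
  qed (simp add: op_mult_def perm_op_def)
qed


section \<open>Series in \<open>u\<^sup>-\<^sup>1\<close>\<close>

text \<open>Power series in \<open>fps_X = u\<^sup>-\<^sup>1\<close>; \<open>recip_u_minus c\<close> is the expansion of \<open>1 / (u - c)\<close>.\<close>

definition recip_u_minus :: "'a::semiring_1 \<Rightarrow> 'a fps"
  where "recip_u_minus c = Abs_fps (\<lambda>k. if k = 0 then 0 else c ^ (k - 1))"

lemma recip_u_minus: "recip_u_minus c * (1 - fps_const c * fps_X) = (fps_X :: 'a::ring_1 fps)"
proof (rule fps_ext)
  fix k
  have "(recip_u_minus c * (1 - fps_const c * fps_X)) $ k
      = recip_u_minus c $ k - (recip_u_minus c * fps_const c * fps_X) $ k"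
    by (simp add: right_diff_distrib mult.assoc)
  then show "(recip_u_minus c * (1 - fps_const c * fps_X)) $ k = (fps_X :: 'a fps) $ k"
    by (cases k; cases "k - 1")
       (auto simp: recip_u_minus_def fps_mult_right_const_nth fps_X_nth power_Suc2 simp del: power_Suc)
qed

text \<open>The substitution \<open>u \<mapsto> u - c\<close>.\<close>

definition shift_series :: "'a::semiring_1 \<Rightarrow> 'a fps \<Rightarrow> 'a fps"
  where "shift_series c f = f oo recip_u_minus c"

text \<open>The expansion of \<open>1 / (a u + c)\<close> for \<open>a \<noteq> 0\<close>, as \<open>u\<^sup>-\<^sup>1 / (a + c u\<^sup>-\<^sup>1)\<close>.\<close>

definition recip_linear :: "complex \<Rightarrow> complex \<Rightarrow> complex fps"
  where "recip_linear a c = fps_X * inverse (fps_const a + fps_const c * fps_X)"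


section \<open>The reflection algebra\<close>

subsection \<open>Free algebras and ideals\<close>

datatype 'g free_monoid = FM (letters: "'g list")

instantiation free_monoid :: (type) monoid_add
begin
definition zero_free_monoid :: "'a free_monoid" where "0 = FM []"
definition plus_free_monoid :: "'a free_monoid \<Rightarrow> 'a free_monoid \<Rightarrow> 'a free_monoid"
  where "x + y = FM (letters x @ letters y)"
instance by standard (simp_all add: zero_free_monoid_def plus_free_monoid_def)
end

text \<open>The product of a monoid algebra is the convolution product on \<^typ>\<open>'k \<Rightarrow>\<^sub>0 complex\<close>.\<close>

type_synonym 'g free_algebra = "'g free_monoid \<Rightarrow>\<^sub>0 complex"

definition free_gen :: "'g \<Rightarrow> 'g free_algebra"
  where "free_gen g = Poly_Mapping.single (FM [g]) 1"

definition free_const :: "complex \<Rightarrow> 'g free_algebra"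
  where "free_const c = Poly_Mapping.single 0 c"

inductive_set two_sided_ideal :: "'a::ring_1 set \<Rightarrow> 'a set" for S
  where
    zero: "0 \<in> two_sided_ideal S"
  | add: "x \<in> two_sided_ideal S \<Longrightarrow> y \<in> two_sided_ideal S \<Longrightarrow> x + y \<in> two_sided_ideal S"
  | gen: "s \<in> S \<Longrightarrow> p * s * q \<in> two_sided_ideal S"

lemma two_sided_ideal_base: "s \<in> S \<Longrightarrow> s \<in> two_sided_ideal S"
  using two_sided_ideal.gen[of s S 1 1] by simp

lemma two_sided_ideal_mult: "x \<in> two_sided_ideal S \<Longrightarrow> a * x * b \<in> two_sided_ideal S"
proof (induction rule: two_sided_ideal.induct)
  case (gen s p q)
  then show ?case
    using two_sided_ideal.gen[of s S "a * p" "q * b"] by (simp add: mult.assoc)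
qed (auto simp: algebra_simps intro: two_sided_ideal.intros)

lemma two_sided_ideal_uminus: "x \<in> two_sided_ideal S \<Longrightarrow> - x \<in> two_sided_ideal S"
  using two_sided_ideal_mult[of x S "- 1" 1] by simp


subsection \<open>Defining relations\<close>

definition sign_eps :: "nat \<Rightarrow> nat \<Rightarrow> complex"
  where "sign_eps m i = (if i \<le> m then 1 else - 1)"

text \<open>The letter \<open>(i, j, r)\<close> stands for \<open>b_{ij}^{(r)}\<close>.\<close>

abbreviation free_b :: "nat \<Rightarrow> nat \<Rightarrow> nat \<Rightarrow> (nat \<times> nat \<times> nat) free_algebra"
  where "free_b i j r \<equiv> free_gen (i, j, r)"

definition free_b_series :: "nat \<Rightarrow> nat \<Rightarrow> (nat \<times> nat \<times> nat) free_algebra fps"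
  where "free_b_series i j = Abs_fps (free_b i j)"

text \<open>
  The reflection equation involves \<open>1 / (u - v)\<close> and \<open>1 / (u + v)\<close>. They are expanded in
  \<open>u\<^sup>-\<^sup>1\<close> with coefficients that are polynomials in \<open>v\<close>, so the equation lives over
  \<open>A((v\<^sup>-\<^sup>1))[[u\<^sup>-\<^sup>1]]\<close>, that is \<^typ>\<open>'a fls fps\<close> with \<open>fls_X_inv\<close> standing for \<open>v\<close>.
\<close>

definition R_op :: "nat \<Rightarrow> 'a::ring_1 fls \<Rightarrow> 'a fls fps tensor_op"
  where "R_op n w = (\<lambda>a b. op_one n 2 a b - recip_u_minus w * swap_op n 2 1 2 a b)"
    \<comment> \<open>\<open>R(u - w)\<close>\<close>

definition series_in_u :: "'a::ring_1 fps \<Rightarrow> 'a fls fps"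
  where "series_in_u f = Abs_fps (\<lambda>r. fls_const (f $ r))"

definition series_in_v :: "'a::ring_1 fps \<Rightarrow> 'a fls fps"
  where "series_in_v f = fps_const (fps_to_fls f)"

definition reflection_lhs :: "nat \<Rightarrow> (nat \<Rightarrow> nat \<Rightarrow> 'a::ring_1 fps) \<Rightarrow> 'a fls fps tensor_op"
  where "reflection_lhs n B = op_prod n 2
    [R_op n fls_X_inv, leg n 2 1 (\<lambda>i j. series_in_u (B i j)),
     R_op n (- fls_X_inv), leg n 2 2 (\<lambda>i j. series_in_v (B i j))]"

definition reflection_rhs :: "nat \<Rightarrow> (nat \<Rightarrow> nat \<Rightarrow> 'a::ring_1 fps) \<Rightarrow> 'a fls fps tensor_op"
  where "reflection_rhs n B = op_prod n 2
    [leg n 2 2 (\<lambda>i j. series_in_v (B i j)), R_op n (- fls_X_inv),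
     leg n 2 1 (\<lambda>i j. series_in_u (B i j)), R_op n fls_X_inv]"

definition unitary_lhs :: "nat \<Rightarrow> (nat \<Rightarrow> nat \<Rightarrow> 'a::ring_1 fps) \<Rightarrow> nat \<Rightarrow> nat \<Rightarrow> 'a fps"
  where "unitary_lhs n B i j = (\<Sum>k\<in>{1..n}. B i k * (B k j oo (- fps_X)))"

text \<open>
  The generators have indices in \<open>{1..m+l}\<close>; the letters with other indices are killed by the last
  set of relations. The other sets are the value of \<open>b_{ij}^{(0)}\<close> and the coefficients of all
  entries of the reflection equation and of the unitary condition.
\<close>

definition reflection_relations :: "nat \<Rightarrow> nat \<Rightarrow> (nat \<times> nat \<times> nat) free_algebra set"
  where "reflection_relations m l = (let n = m + l in
      {free_b i j 0 - (if i = j then free_const (sign_eps m i) else 0) | i j. i \<in> {1..n} \<and> j \<in> {1..n}}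
    \<union> {((reflection_lhs n free_b_series a b - reflection_rhs n free_b_series a b) $ r) $$ s | a b r s.
        a \<in> multi_idx n 2 \<and> b \<in> multi_idx n 2}
    \<union> {(unitary_lhs n free_b_series i j - (if i = j then 1 else 0)) $ r | i j r.
        i \<in> {1..n} \<and> j \<in> {1..n}}
    \<union> {free_b i j r | i j r. \<not> (i \<in> {1..n} \<and> j \<in> {1..n})})"


subsection \<open>The quotient\<close>

text \<open>
  The parameters \<open>m\<close> and \<open>l\<close> are the lengths of the index types \<open>'m\<close> and \<open>'l\<close>; every pair of natural
  numbers arises from numeral types, including zero. Thus \<open>('m, 'l) reflection_algebra\<close> is \<open>\<B>(n, l)\<close> with \<open>n = m + l\<close>.
\<close>

quotient_type (overloaded) ('m, 'l) reflection_algebra =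
  "(nat \<times> nat \<times> nat) free_algebra" /
  "\<lambda>x y. x - y \<in> two_sided_ideal (reflection_relations LENGTH('m::len0) LENGTH('l::len0))"
proof (intro equivpI reflpI sympI transpI)
  let ?I = "two_sided_ideal (reflection_relations LENGTH('m) LENGTH('l))"
  show "x - x \<in> ?I" for x
    by (simp add: two_sided_ideal.zero)
  show "y - x \<in> ?I" if "x - y \<in> ?I" for x y
    using two_sided_ideal_uminus[OF that] by simp
  show "x - z \<in> ?I" if "x - y \<in> ?I" "y - z \<in> ?I" for x y z
    using two_sided_ideal.add[OF that] by simp
qed

instantiation reflection_algebra :: (len0, len0) ring
begin

lift_definition zero_reflection_algebra :: "('a, 'b) reflection_algebra" is 0 .

lift_definition plus_reflection_algebra ::
  "('a, 'b) reflection_algebra \<Rightarrow> ('a, 'b) reflection_algebra \<Rightarrow> ('a, 'b) reflection_algebra" is "(+)"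
  by (metis add_diff_add two_sided_ideal.add)

lift_definition uminus_reflection_algebra ::
  "('a, 'b) reflection_algebra \<Rightarrow> ('a, 'b) reflection_algebra" is uminus
  using two_sided_ideal_uminus by fastforce

lift_definition minus_reflection_algebra ::
  "('a, 'b) reflection_algebra \<Rightarrow> ('a, 'b) reflection_algebra \<Rightarrow> ('a, 'b) reflection_algebra" is "(-)"
proof -
  fix x x' y y' :: "(nat \<times> nat \<times> nat) free_algebra"
  let ?I = "two_sided_ideal (reflection_relations LENGTH('a) LENGTH('b))"
  assume "x - x' \<in> ?I" "y - y' \<in> ?I"
  then have "(x - x') + - (y - y') \<in> ?I"
    by (intro two_sided_ideal.add two_sided_ideal_uminus)
  then show "x - y - (x' - y') \<in> ?I"
    by (simp add: algebra_simps)
qed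

lift_definition times_reflection_algebra ::
  "('a, 'b) reflection_algebra \<Rightarrow> ('a, 'b) reflection_algebra \<Rightarrow> ('a, 'b) reflection_algebra" is "(*)"
proof -
  fix x x' y y' :: "(nat \<times> nat \<times> nat) free_algebra"
  let ?I = "two_sided_ideal (reflection_relations LENGTH('a) LENGTH('b))"
  assume "x - x' \<in> ?I" "y - y' \<in> ?I"
  then have "1 * (x - x') * y + x' * (y - y') * 1 \<in> ?I"
    by (intro two_sided_ideal.add two_sided_ideal_mult)
  then show "x * y - x' * y' \<in> ?I"
    by (simp add: algebra_simps)
qed

instance
  by standard (transfer, simp add: algebra_simps two_sided_ideal.zero)+

end

subsection \<open>The quotient is not trivial\<close>

text \<open>
  The constant matrix \<open>diag(\<epsilon>\<^sub>1, \<dots>, \<epsilon>\<^sub>n)\<close> solves all relations over the complex numbers, so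
  \<open>0 \<noteq> 1\<close> in the quotient.
\<close>

definition counit_word :: "nat \<Rightarrow> nat \<Rightarrow> (nat \<times> nat \<times> nat) free_monoid \<Rightarrow> complex"
  where "counit_word m l w = prod_list (map (\<lambda>(i, j, r).
    if i = j \<and> i \<in> {1..m + l} \<and> r = 0 then sign_eps m i else 0) (letters w))"

definition counit :: "nat \<Rightarrow> nat \<Rightarrow> (nat \<times> nat \<times> nat) free_algebra \<Rightarrow> complex"
  where "counit m l f = (\<Sum>w\<in>Poly_Mapping.keys f. Poly_Mapping.lookup f w * counit_word m l w)"

lemma counit_word_plus: "counit_word m l (v + w) = counit_word m l v * counit_word m l w"
  by (simp add: counit_word_def plus_free_monoid_def)

lemma counit_single [simp]: "counit m l (Poly_Mapping.single w c) = c * counit_word m l w"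
  by (simp add: counit_def)

lemma counit_superset:
  assumes "finite S" "Poly_Mapping.keys f \<subseteq> S"
  shows "counit m l f = (\<Sum>w\<in>S. Poly_Mapping.lookup f w * counit_word m l w)"
  unfolding counit_def using assms by (intro sum.mono_neutral_left) (auto simp: in_keys_iff)

lemma counit_add [simp]: "counit m l (f + g) = counit m l f + counit m l g"
proof -
  let ?S = "Poly_Mapping.keys f \<union> Poly_Mapping.keys g"
  have "Poly_Mapping.keys (f + g) \<subseteq> ?S"
    by (rule Poly_Mapping.keys_add)
  then show ?thesis
    by (simp add: counit_superset[of ?S] lookup_add sum.distrib distrib_right)
qed

lemma counit_zero [simp]: "counit m l 0 = 0"
  by (simp add: counit_def)

lemma free_algebra_induct [case_names single add]:
  fixes f :: "'g free_algebra"
  assumes "\<And>w c. P (Poly_Mapping.single w c)" "\<And>f g. P f \<Longrightarrow> P g \<Longrightarrow> P (f + g)"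
  shows "P f"
proof (induction f rule: update_induct)
  case const
  show ?case using assms(1)[of 0 0] by simp
next
  case (update f a b)
  have "Poly_Mapping.update a b f = f + Poly_Mapping.single a b"
    using update(1)
    by (intro poly_mapping_eqI) (auto simp: lookup_update lookup_add lookup_single in_keys_iff when_def)
  then show ?case using assms update by simp
qed

lemma counit_mult [simp]: "counit m l (f * g) = counit m l f * counit m l g"
proof (induction f rule: free_algebra_induct)
  case (single v c)
  show ?case
    by (induction g rule: free_algebra_induct)
       (simp_all add: mult_single counit_word_plus distrib_left)
qed (simp add: distrib_right)

lemma counit_uminus [simp]: "counit m l (- f) = - counit m l f"
  using counit_add[of m l f "- f"] by (simp add: add_eq_0_iff2 del: counit_add)

lemma counit_diff [simp]: "counit m l (f - g) = counit m l f - counit m l g"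
  using counit_add[of m l f "- g"] by simp

lemma counit_sum [simp]: "counit m l (sum f A) = (\<Sum>x\<in>A. counit m l (f x))"
  by (induction A rule: infinite_finite_induct) auto

lemma counit_one [simp]: "counit m l 1 = 1"
  by (simp add: counit_word_def zero_free_monoid_def flip: single_one)

lemma counit_free_const [simp]: "counit m l (free_const c) = c"
  by (simp add: free_const_def counit_word_def zero_free_monoid_def)

lemma counit_free_b [simp]:
  "counit m l (free_b i j r) = (if i = j \<and> i \<in> {1..m + l} \<and> r = 0 then sign_eps m i else 0)"
  by (simp add: free_gen_def counit_word_def)

definition ker_series :: "nat \<Rightarrow> nat \<Rightarrow> (nat \<times> nat \<times> nat) free_algebra fls fps set"
  where "ker_series m l = {f. \<forall>r s. counit m l (f $ r $$ s) = 0}"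

lemma ker_series_0 [simp]: "0 \<in> ker_series m l"
  by (simp add: ker_series_def)

lemma ker_series_add: "f \<in> ker_series m l \<Longrightarrow> g \<in> ker_series m l \<Longrightarrow> f + g \<in> ker_series m l"
  by (simp add: ker_series_def)

lemma ker_series_diff: "f \<in> ker_series m l \<Longrightarrow> g \<in> ker_series m l \<Longrightarrow> f - g \<in> ker_series m l"
  by (simp add: ker_series_def)

lemma ker_series_mult:
  "f \<in> ker_series m l \<or> g \<in> ker_series m l \<Longrightarrow> f * g \<in> ker_series m l"
  by (auto simp: ker_series_def fps_mult_nth fls_nth_sum fls_times_nth(2) intro!: sum.neutral)

lemma ker_series_sum:
  "(\<And>x. x \<in> A \<Longrightarrow> f x \<in> ker_series m l) \<Longrightarrow> sum f A \<in> ker_series m l"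
  by (induction A rule: infinite_finite_induct) (auto intro: ker_series_add)

lemma op_mult_ker:
  assumes "\<And>a b. X a b - X' a b \<in> ker_series m l" "\<And>a b. Y a b - Y' a b \<in> ker_series m l"
  shows "op_mult n N X Y a b - op_mult n N X' Y' a b \<in> ker_series m l"
proof -
  have "X a c * Y c b - X' a c * Y' c b \<in> ker_series m l" for c
  proof -
    have "X a c * Y c b - X' a c * Y' c b
        = (X a c - X' a c) * Y c b + X' a c * (Y c b - Y' c b)"
      by (simp add: algebra_simps)
    then show ?thesis
      using assms by (simp add: ker_series_add ker_series_mult)
  qed
  then show ?thesis
    by (simp add: op_mult_def sum_subtractf [symmetric] ker_series_sum)
qed

definition diag_eps :: "nat \<Rightarrow> nat \<Rightarrow> nat \<Rightarrow> 'a::ring_1 fps"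
  where "diag_eps m i j = (if i = j then (if i \<le> m then 1 else - 1) else 0)"

lemma recip_commute:
  assumes "c * d = d * (c :: 'a::ring_1)"
  shows "recip_u_minus c * recip_u_minus d = recip_u_minus d * recip_u_minus c"
proof (rule fps_ext)
  fix k
  have comm: "recip_u_minus c $ i * recip_u_minus d $ j = recip_u_minus d $ j * recip_u_minus c $ i" for i j
    using assms by (simp add: recip_u_minus_def power_commuting_commutes)
  show "(recip_u_minus c * recip_u_minus d) $ k = (recip_u_minus d * recip_u_minus c) $ k"
    unfolding fps_mult_nth
    by (rule sum.reindex_bij_witness[of _ "\<lambda>i. k - i" "\<lambda>i. k - i"]) (auto simp: comm)
qed

text \<open>Exchanging the two entries of a multi-index.\<close>

definition flip_idx :: "(nat \<Rightarrow> nat) \<Rightarrow> nat \<Rightarrow> nat"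
  where "flip_idx a = restrict (\<lambda>i. a (transpose 1 2 i)) {1..2}"

lemma flip_idx_simps [simp]: "flip_idx a 1 = a 2" "flip_idx a (Suc 0) = a 2" "flip_idx a 2 = a 1"
  by (auto simp: flip_idx_def)

lemma atLeastAtMost_1_2: "{1..2::nat} = {1, 2}"
  by auto

lemma multi_idx_eq_iff:
  "a \<in> multi_idx n 2 \<Longrightarrow> b \<in> multi_idx n 2 \<Longrightarrow> a = b \<longleftrightarrow> a 1 = b 1 \<and> a 2 = b 2"
  unfolding multi_idx_def atLeastAtMost_1_2 by (auto intro!: PiE_ext[of a "{1, 2}"])

lemma flip_idx_in [simp]: "a \<in> multi_idx n 2 \<Longrightarrow> flip_idx a \<in> multi_idx n 2"
  unfolding multi_idx_def flip_idx_def atLeastAtMost_1_2 by (auto simp: transpose_def)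

lemma flip_idx_flip_idx [simp]: "a \<in> multi_idx n 2 \<Longrightarrow> flip_idx (flip_idx a) = a"
  by (subst multi_idx_eq_iff) auto

lemma swap_op_eq:
  "swap_op n 2 1 2 = (\<lambda>a b. if a \<in> multi_idx n 2 \<and> b = flip_idx a then 1 else 0)"
proof (intro ext)
  fix a b
  show "swap_op n 2 1 2 a b = (if a \<in> multi_idx n 2 \<and> b = flip_idx a then 1 else 0)"
  proof (cases "a \<in> multi_idx n 2 \<and> b \<in> multi_idx n 2")
    case True
    then show ?thesis
      unfolding perm_op_def atLeastAtMost_1_2 by (auto simp: multi_idx_eq_iff)
  qed (auto simp: perm_op_def)
qed

lemma leg_diag_eq:
  assumes "s \<in> {1..N}" "\<And>i j. i \<noteq> j \<Longrightarrow> X i j = 0"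
  shows "leg n N s X = (\<lambda>a b. if a \<in> multi_idx n N \<and> a = b then X (a s) (a s) else 0)"
proof (intro ext)
  fix a b
  have "a = b" if "a \<in> multi_idx n N" "b \<in> multi_idx n N" "\<forall>t\<in>{1..N} - {s}. a t = b t" "a s = b s"
    using that unfolding multi_idx_def by (intro PiE_ext[of a "{1..N}" "\<lambda>_. {1..n}"]) auto
  then show "leg n N s X a b = (if a \<in> multi_idx n N \<and> a = b then X (a s) (a s) else 0)"
    using assms(2)[of "a s" "b s"] by (auto simp: leg_def)
qed

lemma op_mult_diag:
  "op_mult n N (\<lambda>a b. if a \<in> multi_idx n N \<and> a = b then d a else 0) Y a b
    = (if a \<in> multi_idx n N then d a * Y a b else 0)"
proof -
  have "op_mult n N (\<lambda>a b. if a \<in> multi_idx n N \<and> a = b then d a else 0) Y a b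
      = (\<Sum>c\<in>multi_idx n N. if a = c then d a * Y a b else 0)"
    unfolding op_mult_def by (intro sum.cong) auto
  then show ?thesis by simp
qed

lemma op_mult_R:
  "op_mult n 2 (R_op n w) Y a b
    = (if a \<in> multi_idx n 2 then Y a b - recip_u_minus w * Y (flip_idx a) b else 0)"
proof -
  have "op_mult n 2 (R_op n w) Y a b
      = (\<Sum>c\<in>multi_idx n 2. if a = c then Y a b else 0)
        - (\<Sum>c\<in>multi_idx n 2. if c = flip_idx a \<and> a \<in> multi_idx n 2
              then recip_u_minus w * Y (flip_idx a) b else 0)"
    unfolding op_mult_def R_op_def op_one_def swap_op_eq sum_subtractf [symmetric]
    by (intro sum.cong) (auto simp: left_diff_distrib)
  also have "\<dots> = (if a \<in> multi_idx n 2 then Y a b - recip_u_minus w * Y (flip_idx a) b else 0)"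
    by (auto simp: if_distrib cong: if_cong)
  finally show ?thesis .
qed

lemma reflection_diag_eps:
  assumes "a \<in> multi_idx n 2"
  shows "reflection_lhs n (diag_eps m) a b = (reflection_rhs n (diag_eps m) a b :: 'a::ring_1 fls fps)"
proof -
  define g :: "nat \<Rightarrow> 'a fls fps" where "g = (\<lambda>i. if i \<le> m then 1 else - 1)"
  have u: "series_in_u (diag_eps m i j :: 'a fps) = (if i = j then g i else 0)" for i j
    by (rule fps_ext) (auto simp: series_in_u_def diag_eps_def g_def)
  have v: "series_in_v (diag_eps m i j :: 'a fps) = (if i = j then g i else 0)" for i j
    by (auto simp: series_in_v_def diag_eps_def g_def simp flip: fps_const_neg)
  have comm: "recip_u_minus (- fls_X_inv) * recip_u_minus fls_X_inv
      = (recip_u_minus fls_X_inv * recip_u_minus (- fls_X_inv) :: 'a fls fps)"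
    by (rule recip_commute) simp
  have L1: "leg n 2 1 (\<lambda>i j. series_in_u (diag_eps m i j :: 'a fps))
      = (\<lambda>a b. if a \<in> multi_idx n 2 \<and> a = b then g (a 1) else 0)"
    by (subst leg_diag_eq) (auto simp: u fun_eq_iff)
  have L2: "leg n 2 2 (\<lambda>i j. series_in_v (diag_eps m i j :: 'a fps))
      = (\<lambda>a b. if a \<in> multi_idx n 2 \<and> a = b then g (a 2) else 0)"
    by (subst leg_diag_eq) (auto simp: v fun_eq_iff)
  define \<delta> \<phi> :: "'a fls fps"
    where "\<delta> = (if a = b then 1 else 0)" and "\<phi> = (if flip_idx a = b then 1 else 0)"
  define p q :: "'a fls fps"
    where "p = recip_u_minus fls_X_inv" and "q = recip_u_minus (- fls_X_inv)"
  have one: "op_one n 2 a b = \<delta>" "op_one n 2 (flip_idx a) b = \<phi>"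
    using assms by (simp_all only: op_one_def \<delta>_def \<phi>_def flip_idx_in if_True simp_thms)
  note rules = op_mult_diag op_mult_R assms flip_idx_in flip_idx_flip_idx [OF assms] flip_idx_simps
    if_True list.simps foldr_Cons foldr_Nil comp_apply id_apply one p_def [symmetric] q_def [symmetric]
  have "reflection_lhs n (diag_eps m) a b
      = g (a 1) * (g (a 2) * \<delta> - q * (g (a 1) * \<phi>)) - p * (g (a 2) * (g (a 1) * \<phi> - q * (g (a 2) * \<delta>)))"
    unfolding reflection_lhs_def op_prod_def L1 L2 by (simp only: rules)
  moreover have "reflection_rhs n (diag_eps m) a b
      = g (a 2) * (g (a 1) * (\<delta> - p * \<phi>) - q * (g (a 2) * (\<phi> - p * \<delta>)))"
    unfolding reflection_rhs_def op_prod_def L1 L2 by (simp only: rules)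
  moreover have "g (a 1) = 1 \<or> g (a 1) = - 1" "g (a 2) = 1 \<or> g (a 2) = - 1"
    by (simp_all add: g_def)
  then have "g (a 1) * (g (a 2) * \<delta> - q * (g (a 1) * \<phi>)) - p * (g (a 2) * (g (a 1) * \<phi> - q * (g (a 2) * \<delta>)))
      = g (a 2) * (g (a 1) * (\<delta> - p * \<phi>) - q * (g (a 2) * (\<phi> - p * \<delta>)))"
  proof -
    have "q * (p * x) = p * (q * x)" for x
      unfolding p_def q_def using comm by (simp flip: mult.assoc)
    then show ?thesis
      using \<open>g (a 1) = 1 \<or> g (a 1) = - 1\<close> \<open>g (a 2) = 1 \<or> g (a 2) = - 1\<close>
      by (elim disjE) (simp_all add: algebra_simps)
  qed
  ultimately show ?thesis
    by (simp only:)
qed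

lemma counit_reflection:
  "counit m l ((reflection_lhs (m + l) free_b_series a b - reflection_rhs (m + l) free_b_series a b) $ r $$ s) = 0"
proof (cases "a \<in> multi_idx (m + l) 2")
  case True
  let ?n = "m + l"
  let ?G = "diag_eps m :: nat \<Rightarrow> nat \<Rightarrow> (nat \<times> nat \<times> nat) free_algebra fps"
  have coeff: "counit m l (free_b_series i j $ r) = counit m l (?G i j $ r)"
    if "i \<in> {1..?n}" for i j r
    using that by (auto simp: free_b_series_def diag_eps_def sign_eps_def)
  have L1: "leg ?n 2 1 (\<lambda>i j. series_in_u (free_b_series i j)) a b
      - leg ?n 2 1 (\<lambda>i j. series_in_u (?G i j)) a b \<in> ker_series m l" for a b
  proof -
    have "a 1 \<in> {1..?n}" if "a \<in> multi_idx ?n 2"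
      using that by (auto simp: multi_idx_def)
    then show ?thesis
      by (auto simp: leg_def ker_series_def series_in_u_def coeff)
  qed
  have L2: "leg ?n 2 2 (\<lambda>i j. series_in_v (free_b_series i j)) a b
      - leg ?n 2 2 (\<lambda>i j. series_in_v (?G i j)) a b \<in> ker_series m l" for a b
  proof -
    have "a 2 \<in> {1..?n}" if "a \<in> multi_idx ?n 2"
      using that by (auto simp: multi_idx_def)
    then show ?thesis
      by (auto simp: leg_def ker_series_def series_in_v_def coeff)
  qed
  have "reflection_lhs ?n free_b_series a b - reflection_lhs ?n ?G a b \<in> ker_series m l"
    "reflection_rhs ?n free_b_series a b - reflection_rhs ?n ?G a b \<in> ker_series m l"
    unfolding reflection_lhs_def reflection_rhs_def op_prod_def
    using L1 L2 by (auto intro!: op_mult_ker)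
  from ker_series_diff[OF this] show ?thesis
    unfolding reflection_diag_eps[OF True] by (simp add: ker_series_def)
next
  case False
  then show ?thesis
    by (simp add: reflection_lhs_def reflection_rhs_def op_prod_def op_mult_def R_op_def leg_def
        op_one_def perm_op_def)
qed

lemma counit_unitary:
  assumes "i \<in> {1..m + l}" "j \<in> {1..m + l}"
  shows "counit m l ((unitary_lhs (m + l) free_b_series i j - (if i = j then 1 else 0)) $ r) = 0"
proof -
  define d where "d i j r = (if i = j \<and> r = 0 then sign_eps m i else 0)" for i j r :: nat
  have coeff: "counit m l (free_b_series i j $ r) = d i j r" if "i \<in> {1..m + l}" for i j r
    using that by (auto simp: free_b_series_def d_def)
  have coeff': "counit m l ((free_b_series k j oo (- fps_X)) $ r) = d k j r"
    if "k \<in> {1..m + l}" for k j r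
  proof -
    have "counit m l ((free_b_series k j oo (- fps_X)) $ r)
        = (\<Sum>q\<in>{0..r}. if q = 0 then d k j 0 * counit m l (((- fps_X) ^ q) $ r) else 0)"
      unfolding fps_compose_nth counit_sum counit_mult
      by (intro sum.cong) (use that in \<open>auto simp: coeff d_def\<close>)
    also have "\<dots> = d k j r"
      by (simp add: d_def)
    finally show ?thesis .
  qed
  have "counit m l (unitary_lhs (m + l) free_b_series i j $ r)
      = (\<Sum>k\<in>{1..m + l}. \<Sum>q = 0..r. d i k q * d k j (r - q))"
    unfolding unitary_lhs_def fps_sum_nth fps_mult_nth counit_sum counit_mult
    using assms by (intro sum.cong refl) (simp add: coeff coeff')
  also have "\<dots> = (\<Sum>k\<in>{1..m + l}. if k = i then (\<Sum>q = 0..r. if q = 0 then d i i 0 * d i j r else 0) else 0)"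
    by (intro sum.cong refl) (auto simp: d_def intro!: sum.cong sum.neutral)
  also have "\<dots> = d i i 0 * d i j r"
    using assms by simp
  also have "\<dots> = (if i = j \<and> r = 0 then 1 else 0)"
    by (simp add: d_def sign_eps_def)
  finally show ?thesis
    by simp
qed

lemma counit_relations: "x \<in> reflection_relations m l \<Longrightarrow> counit m l x = 0"
  unfolding reflection_relations_def Let_def
proof (elim UnE CollectE exE conjE, goal_cases)
  case (2 a b r s)
  then show ?case by (simp only: counit_reflection)
next
  case (3 i j r)
  then show ?case by (simp only: counit_unitary)
qed auto

lemma counit_ideal: "x \<in> two_sided_ideal (reflection_relations m l) \<Longrightarrow> counit m l x = 0"
  by (induction rule: two_sided_ideal.induct) (simp_all add: counit_relations)

instantiation reflection_algebra :: (len0, len0) ring_1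
begin

lift_definition one_reflection_algebra :: "('a, 'b) reflection_algebra" is 1 .

instance
proof
  show "1 * x = x" "x * 1 = x" for x :: "('a, 'b) reflection_algebra"
    by (transfer, simp add: two_sided_ideal.zero)+
  show "(0 :: ('a, 'b) reflection_algebra) \<noteq> 1"
    by transfer (use counit_ideal[of "0 - 1" "LENGTH('a)" "LENGTH('b)"] in auto)
qed

end

lift_definition alg_const :: "complex \<Rightarrow> ('m::len0, 'l::len0) reflection_algebra"
  is free_const .

lift_definition gen_b :: "nat \<Rightarrow> nat \<Rightarrow> nat \<Rightarrow> ('m::len0, 'l::len0) reflection_algebra"
  is "\<lambda>i j r. free_b i j r" .

text \<open>The structure of a complex algebra is given by a central ring homomorphism.\<close>

lemma free_const_central: "free_const c * x = x * free_const c"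
proof (induction x rule: free_algebra_induct)
  case (single w d)
  show ?case by (simp add: free_const_def mult_single mult.commute)
qed (simp add: algebra_simps)

lemma alg_const_hom:
  "alg_const 0 = 0" "alg_const 1 = 1"
  "alg_const (c + d) = alg_const c + alg_const d"
  "alg_const (c * d) = alg_const c * alg_const d"
  by (transfer, simp add: free_const_def single_add mult_single two_sided_ideal.zero)+

lemma alg_const_central: "alg_const c * x = x * alg_const c"
  by transfer (simp add: free_const_central two_sided_ideal.zero)

lemma gen_b_0:
  assumes "i \<in> {1..LENGTH('m) + LENGTH('l)}" "j \<in> {1..LENGTH('m) + LENGTH('l)}"
  shows "(gen_b i j 0 :: ('m::len0, 'l::len0) reflection_algebra)
    = (if i = j then alg_const (sign_eps LENGTH('m) i) else 0)"
proof -
  have "free_b i j 0 - (if i = j then free_const (sign_eps LENGTH('m) i) else 0)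
      \<in> two_sided_ideal (reflection_relations LENGTH('m) LENGTH('l))"
    using assms by (intro two_sided_ideal_base) (unfold reflection_relations_def Let_def, blast)
  then show ?thesis
    by (simp add: gen_b.abs_eq alg_const.abs_eq zero_reflection_algebra.abs_eq
        reflection_algebra.abs_eq_iff split: if_splits)
qed


section \<open>The two sides of the expansion\<close>

definition series_const :: "complex fps \<Rightarrow> ('m::len0, 'l::len0) reflection_algebra fps"
  where "series_const f = Abs_fps (\<lambda>r. alg_const (f $ r))"

definition b_series :: "nat \<Rightarrow> nat \<Rightarrow> ('m::len0, 'l::len0) reflection_algebra fps"
  where "b_series i j = Abs_fps (gen_b i j)"

text \<open>\<open>B_leg s c = B_s(u - c)\<close>\<close>

definition B_leg :: "nat \<Rightarrow> nat \<Rightarrow> ('m::len0, 'l::len0) reflection_algebra fps tensor_op"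
  where "B_leg s c = (let n = LENGTH('m) + LENGTH('l) in
    leg n n s (\<lambda>i j. shift_series (of_nat c) (b_series i j)))"

definition Pi_op :: "nat \<Rightarrow> ('m::len0, 'l::len0) reflection_algebra fps tensor_op"
  where "Pi_op k = (let n = LENGTH('m) + LENGTH('l) in
    (\<lambda>a b. op_one n n a b
      - series_const (recip_linear 2 (- of_nat k - of_nat n + 2)) * (\<Sum>i\<in>{k+1..n}. swap_op n n k i a b)))"

definition bracket_B :: "('m::len0, 'l::len0) reflection_algebra fps tensor_op"
  where "bracket_B = (let n = LENGTH('m) + LENGTH('l) in
    op_prod n n (concat (map (\<lambda>k. B_leg k (k - 1) # (if k < n then [Pi_op k] else [])) [1..<Suc n])))"

text \<open>
  The words of the cycles of \<open>\<sigma>\<close> on \<open>{1..n}\<close>, fixed points included. The word of each cycle is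
  started at its maximal element.
\<close>

definition cycle_words :: "nat \<Rightarrow> (nat \<Rightarrow> nat) \<Rightarrow> nat list list"
  where "cycle_words n \<sigma> =
    map (support \<sigma>) (filter (\<lambda>g. g = Max (set (support \<sigma> g))) [1..<Suc n])"

definition max_elements :: "nat \<Rightarrow> (nat \<Rightarrow> nat) \<Rightarrow> nat set"
  where "max_elements n \<sigma> = {Max (set w) | w. w \<in> set (cycle_words n \<sigma>)}"

definition words_perm :: "nat list list \<Rightarrow> nat \<Rightarrow> nat"
  where "words_perm ws = foldr (\<circ>) (map cycle_of_list ws) id"

definition word_restriction :: "nat \<Rightarrow> (nat \<Rightarrow> nat) \<Rightarrow> nat set \<Rightarrow> nat \<Rightarrow> nat"
  where "word_restriction n \<sigma> G = words_perm (map (filter (\<lambda>x. x \<in> G)) (cycle_words n \<sigma>))"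

definition alpha_bar :: "nat \<Rightarrow> (nat \<Rightarrow> nat) \<Rightarrow> complex fps"
  where "alpha_bar n \<sigma> =
    (\<Prod>g\<in>{1..n} - max_elements n \<sigma>. recip_linear (- 2) (of_nat n - 2 + of_nat g))"

end

(*
  Expanding every Pi_k gives a sum over products T_1 ... T_{n-1}, where T_k is 1 or a transposition
  (k i) with i > k. Moving the T_k to the left turns B_k into B_{T_{n-1} ... T_k (k)}, and every
  permutation sigma is T_{n-1} ... T_1 for exactly one choice of the T_k. Composing tau, which fixes
  1, ..., k, with (k i) on the right inserts k after i into a cycle of tau. Hence T_{n-1} ... T_k
  is the word restriction of sigma on {k..n}, and T_k is 1 iff k is the maximum of its cycle.
*)

theory Submission
  imports Defs
begin

section \<open>Deleting a point from a permutation\<close>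

text \<open>For a bijection \<sigma>, the predecessor \<open>inv \<sigma> k\<close> is sent straight
  to \<open>\<sigma> k\<close> and k becomes fixed: k is cut out of its cycle. The form with a
  transposition makes this the inverse of inserting k by a transposition.\<close>

definition del_point :: "'a \<Rightarrow> ('a \<Rightarrow> 'a) \<Rightarrow> 'a \<Rightarrow> 'a"
  where "del_point k \<sigma> = \<sigma> \<circ> transpose k (inv \<sigma> k)"

lemma del_point_fixed:
  assumes "bij \<sigma>" "\<sigma> k = k"
  shows "del_point k \<sigma> = \<sigma>"
  using assms by (simp add: del_point_def bij_is_inj inv_f_eq)

text \<open>As \<sigma> fixes k, the preimages of k under \<tau> and
  \<open>\<sigma> \<circ> \<tau>\<close> agree. This lets the deletion pass over cycles that do not
  contain k.\<close>

lemma del_point_comp_fixed: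
  assumes "bij \<sigma>" "bij \<tau>" "\<sigma> k = k"
  shows "del_point k (\<sigma> \<circ> \<tau>) = \<sigma> \<circ> del_point k \<tau>"
proof -
  have "inv \<sigma> k = k"
    using assms by (simp add: bij_is_inj inv_f_eq)
  then show ?thesis
    using assms by (simp add: del_point_def o_inv_distrib comp_assoc)
qed

text \<open>For h \<noteq> k, multiplying by \<open>transpose k h\<close> on the left inserts k just
  before h in the cycle of \<tau>, which is how a letter is put in front of a cycle word.\<close>

lemma del_point_transpose_comp:
  assumes "bij \<tau>" "\<tau> k = k"
  shows "del_point k (transpose k h \<circ> \<tau>) = \<tau>"
proof
  fix x
  have inv: "inv (transpose k h \<circ> \<tau>) k = inv \<tau> h"
    using assms by (simp add: o_inv_distrib)
  have h: "\<tau> (inv \<tau> h) = h"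
    using assms by (simp add: bij_is_surj surj_f_inv_f)
  show "del_point k (transpose k h \<circ> \<tau>) x = \<tau> x"
  proof (cases "x = k \<or> x = inv \<tau> h")
    case True
    then show ?thesis
      using h assms by (auto simp: del_point_def inv)
  next
    case False
    then have "\<tau> x \<noteq> k" "\<tau> x \<noteq> h"
      using assms h by (metis bij_pointE inv_f_f bij_is_inj)+
    then show ?thesis
      using False by (simp add: del_point_def inv transpose_def)
  qed
qed

text \<open>The preimage of k under \<open>\<tau> \<circ> transpose k i\<close> is i, so the
  deletion multiplies by the same transposition again and the two cancel.\<close>

lemma del_point_comp_transpose:
  assumes "bij \<tau>" "\<tau> k = k"
  shows "del_point k (\<tau> \<circ> transpose k i) = \<tau>"
proof -
  have "inv \<tau> k = k"
    using assms by (simp add: bij_is_inj inv_f_eq)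
  then show ?thesis
    using assms by (simp add: del_point_def o_inv_distrib comp_assoc)
qed

section \<open>Cycles given by words\<close>

lemma bij_cycle_of_list: "bij (cycle_of_list w)"
  by (rule permutation_bijective [OF permutation_of_cycle])

lemma cycle_of_list_Cons:
  assumes "w \<noteq> []"
  shows "cycle_of_list (k # w) = transpose k (hd w) \<circ> cycle_of_list w"
  using assms by (cases w) auto

lemma cycle_of_list_append_commute:
  assumes "distinct (xs @ ys)"
  shows "cycle_of_list (xs @ ys) = cycle_of_list (ys @ xs)"
  using cycle_of_list_rotate_independent [OF assms, of "length xs"] by (simp add: rotate_append)

text \<open>The cycle does not depend on where its word starts, so k may be moved to the front; what
  follows is, up to rotation, the word without k.\<close>

lemma cycle_of_list_rotate_to:
  assumes "distinct w" "k \<in> set w"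
  obtains z where "cycle_of_list w = cycle_of_list (k # z)" "k \<notin> set z"
    "cycle_of_list (filter (\<lambda>x. x \<noteq> k) w) = cycle_of_list z" "length w = Suc (length z)"
proof -
  obtain xs ys where w: "w = xs @ k # ys"
    using assms(2) by (meson split_list)
  show thesis
  proof (rule that [of "ys @ xs"])
    show "cycle_of_list w = cycle_of_list (k # ys @ xs)"
      using cycle_of_list_append_commute [of xs "k # ys"] assms w by simp
    have "filter (\<lambda>x. x \<noteq> k) w = xs @ ys"
      using assms w by (auto intro!: arg_cong2 [of _ _ _ _ append] filter_True)
    then show "cycle_of_list (filter (\<lambda>x. x \<noteq> k) w) = cycle_of_list (ys @ xs)"
      using cycle_of_list_append_commute [of xs ys] assms w by simp
  qed (use assms w in auto)
qed

text \<open>With k rotated to the front, its image is the next letter, which differs from k whenever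
  there is one.\<close>

lemma cycle_of_list_fixed_iff:
  assumes "distinct w" "k \<in> set w"
  shows "cycle_of_list w k = k \<longleftrightarrow> w = [k]"
proof -
  obtain z where z: "cycle_of_list w = cycle_of_list (k # z)" "k \<notin> set z" "length w = Suc (length z)"
    using cycle_of_list_rotate_to [OF assms] by metis
  show ?thesis
  proof (cases "z = []")
    case True
    then have "w = [k]"
      using z(3) assms(2) by (cases w) auto
    then show ?thesis
      by simp
  next
    case False
    then have "cycle_of_list w k = hd z"
      using z by (simp add: cycle_of_list_Cons id_outside_supp)
    moreover have "hd z \<noteq> k" "w \<noteq> [k]"
      using False z(2,3) by auto
    ultimately show ?thesis
      by simp
  qed
qed

lemma singleton_list_iff:
  assumes "distinct xs"
  shows "xs = [g] \<longleftrightarrow> set xs = {g}"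
  using assms by (cases xs) (auto dest: subset_singletonD)

section \<open>Products of disjoint cycles\<close>

lemma words_perm_simps [simp]:
  "words_perm [] = id" "words_perm (w # ws) = cycle_of_list w \<circ> words_perm ws"
  by (simp_all add: words_perm_def)

lemma bij_words_perm: "bij (words_perm ws)"
  by (induction ws) (simp_all only: words_perm_simps bij_id bij_comp bij_cycle_of_list)

lemma words_perm_outside: "x \<notin> set (concat ws) \<Longrightarrow> words_perm ws x = x"
  by (induction ws) (auto simp: id_outside_supp)

text \<open>Only the cycle of w moves x, and the image stays among the letters of w, out of reach of
  the cycles applied later.\<close>

lemma words_perm_inside:
  assumes "distinct (concat ws)" "w \<in> set ws" "x \<in> set w"
  shows "words_perm ws x = cycle_of_list w x"
  using assms
proof (induction ws)
  case (Cons v ws)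
  show ?case
  proof (cases "w \<in> set ws")
    case True
    then have "words_perm ws x = cycle_of_list w x"
      using Cons by auto
    moreover have "cycle_of_list w x \<in> set w"
      using permutes_in_image [OF cycle_permutes] Cons.prems(3) by metis
    then have "cycle_of_list w x \<notin> set v"
      using Cons.prems(1) True by auto
    ultimately show ?thesis
      by (simp add: id_outside_supp)
  next
    case False
    then have "w = v"
      using Cons.prems by auto
    moreover have "words_perm ws x = x"
      using Cons.prems \<open>w = v\<close> by (intro words_perm_outside) auto
    ultimately show ?thesis
      by simp
  qed
qed simp

text \<open>The letter k occurs in at most one word. Words without k are passed over; in its own
  word, k is rotated to the front and split off as a transposition, which the deletion
  removes.\<close>

lemma words_perm_delete:
  assumes "distinct (concat ws)"
  shows "words_perm (map (filter (\<lambda>x. x \<noteq> k)) ws) = del_point k (words_perm ws)"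
  using assms
proof (induction ws)
  case Nil
  then show ?case by (simp add: del_point_def)
next
  case (Cons w ws)
  show ?case
  proof (cases "k \<in> set w")
    case True
    have filt: "map (filter (\<lambda>x. x \<noteq> k)) ws = ws"
      using Cons.prems True by (intro map_idI) (auto simp: filter_id_conv)
    have fix': "words_perm ws k = k"
      using Cons.prems True by (intro words_perm_outside) auto
    have "distinct w"
      using Cons.prems by simp
    then obtain z where z: "cycle_of_list w = cycle_of_list (k # z)" "k \<notin> set z"
        "cycle_of_list (filter (\<lambda>x. x \<noteq> k) w) = cycle_of_list z"
      using True by (rule cycle_of_list_rotate_to)
    show ?thesis
    \<comment> \<open>If k is alone in its word, the whole product fixes k and there is no
      transposition to split off.\<close>
    proof (cases "z = []")
      case True
      then show ?thesis
        using filt z fix' by (simp add: del_point_fixed bij_words_perm)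
    next
      case False
      have "bij (cycle_of_list z \<circ> words_perm ws)"
        by (intro bij_comp bij_cycle_of_list bij_words_perm)
      moreover have "(cycle_of_list z \<circ> words_perm ws) k = k"
        using fix' z(2) by (simp add: id_outside_supp)
      ultimately have "del_point k (transpose k (hd z) \<circ> (cycle_of_list z \<circ> words_perm ws))
          = cycle_of_list z \<circ> words_perm ws"
        by (rule del_point_transpose_comp)
      then show ?thesis
        by (simp only: list.map filt words_perm_simps z(1,3) cycle_of_list_Cons [OF False] comp_assoc)
    qed
  next
    case False
    then have "filter (\<lambda>x. x \<noteq> k) w = w"
      by (auto simp: filter_id_conv)
    moreover have "del_point k (cycle_of_list w \<circ> words_perm ws) = cycle_of_list w \<circ> del_point k (words_perm ws)"
      using False by (intro del_point_comp_fixed bij_cycle_of_list bij_words_perm id_outside_supp)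
    moreover have "words_perm (map (filter (\<lambda>x. x \<noteq> k)) ws) = del_point k (words_perm ws)"
      using Cons by simp
    ultimately show ?thesis
      by (simp only: list.map words_perm_simps)
  qed
qed

lemma distinct_concat_map_filter:
  "distinct (concat ws) \<Longrightarrow> distinct (concat (map (filter P) ws))"
  by (simp flip: filter_concat)


section \<open>Word restrictions\<close>

text \<open>A constant in place of the abbreviation \<open>support\<close>, whose unfolded form the simplifier would rewrite.\<close>

definition cycle_word :: "('a \<Rightarrow> 'a) \<Rightarrow> 'a \<Rightarrow> 'a list"
  where "cycle_word \<sigma> x = support \<sigma> x"

lemma cycle_word_refl: "permutation \<sigma> \<Longrightarrow> x \<in> set (cycle_word \<sigma> x)"
  unfolding cycle_word_def support_set by (auto intro: range_eqI [of _ _ 0])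

lemma cycle_word_eq:
  assumes "permutation \<sigma>" "set (cycle_word \<sigma> x) \<inter> set (cycle_word \<sigma> y) \<noteq> {}"
  shows "set (cycle_word \<sigma> x) = set (cycle_word \<sigma> y)"
  using disjoint_support [OF assms(1)] assms(2) unfolding disjoint_def cycle_word_def by blast

section \<open>Cycle words of a permutation of \<open>{1..n}\<close>\<close>

context
  fixes n :: nat and \<sigma> :: "nat \<Rightarrow> nat"
  assumes \<sigma>: "\<sigma> permutes {1..n}"
begin

lemma permutation_cycle_words: "permutation \<sigma>"
  using \<sigma> permutation_permutes by blast

lemma set_cycle_words:
  "w \<in> set (cycle_words n \<sigma>) \<longleftrightarrow> (\<exists>g\<in>{1..n}. w = cycle_word \<sigma> g \<and> g = Max (set w))"
  unfolding cycle_words_def cycle_word_def [symmetric] by auto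

lemma cycle_word_subset:
  assumes "g \<in> {1..n}"
  shows "set (cycle_word \<sigma> g) \<subseteq> {1..n}"
  unfolding cycle_word_def support_set [OF permutation_cycle_words]
  using permutes_in_image [OF permutes_funpow [OF \<sigma>]] assms by blast

lemma cycle_words_subset:
  assumes "w \<in> set (cycle_words n \<sigma>)"
  shows "set w \<subseteq> {1..n}"
proof -
  obtain g where "g \<in> {1..n}" "w = cycle_word \<sigma> g"
    using assms unfolding set_cycle_words by blast
  then show ?thesis
    by (simp only: cycle_word_subset)
qed

lemma cycle_words_cover:
  assumes x: "x \<in> {1..n}"
  obtains w where "w \<in> set (cycle_words n \<sigma>)" "x \<in> set w"
proof -
  \<comment> \<open>A cycle is listed only with its maximum as starting point, so the listed word is
    the one started at g, not at x.\<close>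
  define g where "g = Max (set (cycle_word \<sigma> x))"
  have x_in: "x \<in> set (cycle_word \<sigma> x)"
    by (rule cycle_word_refl [OF permutation_cycle_words])
  then have g: "g \<in> set (cycle_word \<sigma> x)"
    unfolding g_def by (intro Max_in) auto
  then have eq: "set (cycle_word \<sigma> g) = set (cycle_word \<sigma> x)"
    using cycle_word_refl [OF permutation_cycle_words, of g]
    by (intro cycle_word_eq [OF permutation_cycle_words]) auto
  have "g \<in> {1..n}"
    using g cycle_word_subset [OF x] by blast
  then have "cycle_word \<sigma> g \<in> set (cycle_words n \<sigma>)"
    unfolding set_cycle_words using eq g_def by (intro bexI [of _ g]) simp_all
  moreover have "x \<in> set (cycle_word \<sigma> g)"
    using eq x_in by simp
  ultimately show thesis
    by (rule that)
qed

lemma distinct_cycle_words: "distinct (concat (cycle_words n \<sigma>))"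
proof (subst distinct_concat_iff, intro conjI allI impI ballI)
  \<comment> \<open>The starting point of a listed word is recovered as its maximum.\<close>
  have "inj_on (cycle_word \<sigma>) {g. g = Max (set (cycle_word \<sigma> g))}"
    by (rule inj_on_inverseI [of _ "\<lambda>w. Max (set w)"]) (drule CollectD, erule sym)
  then have "inj_on (cycle_word \<sigma>) (set (filter (\<lambda>g. g = Max (set (cycle_word \<sigma> g))) [1..<Suc n]))"
    by (rule inj_on_subset) (simp only: set_filter, blast)
  then have "distinct (cycle_words n \<sigma>)"
    unfolding cycle_words_def cycle_word_def [symmetric] distinct_map
    by (intro conjI distinct_filter distinct_upt)
  then show "distinct (removeAll [] (cycle_words n \<sigma>))"
    by (simp add: distinct_removeAll)
  show "distinct w" if "w \<in> set (cycle_words n \<sigma>)" for w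
    using that cycle_of_permutation [OF permutation_cycle_words, folded cycle_word_def]
    unfolding set_cycle_words by blast
  show "set v \<inter> set w = {}"
    if vw: "v \<in> set (cycle_words n \<sigma>) \<and> w \<in> set (cycle_words n \<sigma>) \<and> v \<noteq> w" for v w
  proof -
    obtain g h where g: "v = cycle_word \<sigma> g" "g = Max (set v)" and h: "w = cycle_word \<sigma> h" "h = Max (set w)"
      using vw unfolding set_cycle_words by blast
    \<comment> \<open>Two cycles are equal or disjoint as sets, and equal sets have the same
      maximum, hence the same starting point.\<close>
    have "set v \<noteq> set w"
    proof
      assume "set v = set w"
      then have "g = h"
        unfolding g(2) h(2) by (rule arg_cong)
      then show False
        using vw g(1) h(1) by simp
    qed
    then show ?thesis
      using cycle_word_eq [OF permutation_cycle_words, of g h] unfolding g(1) [symmetric] h(1) [symmetric]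
      by argo
  qed
qed

lemma words_perm_cycle_words: "words_perm (cycle_words n \<sigma>) = \<sigma>"
proof
  fix x
  show "words_perm (cycle_words n \<sigma>) x = \<sigma> x"
  proof (cases "x \<in> {1..n}")
    case True
    then obtain w where w: "w \<in> set (cycle_words n \<sigma>)" "x \<in> set w"
      by (rule cycle_words_cover)
    then obtain g where "w = cycle_word \<sigma> g"
      unfolding set_cycle_words by blast
    then show ?thesis
      using words_perm_inside [OF distinct_cycle_words w] w(2)
        cycle_restrict [OF permutation_cycle_words, folded cycle_word_def] by metis
  next
    case False
    then show ?thesis
      using words_perm_outside [of x "cycle_words n \<sigma>"] cycle_words_subset permutes_not_in [OF \<sigma>]
      by fastforce
  qed
qed

text \<open>Shrinking \<open>{k..n}\<close> to \<open>{Suc k..n}\<close> deletes the single letter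
  k. This trades words for a recursion on permutations, the form in which the expansion produces the
  legs.\<close>

lemma word_restriction_eq_fold:
  assumes "1 \<le> k"
  shows "word_restriction n \<sigma> {k..n} = fold del_point [1..<k] \<sigma>"
  using assms
proof (induction k rule: nat_induct_at_least)
  case base
  have "filter (\<lambda>x. x \<in> {1..n}) w = w" if "w \<in> set (cycle_words n \<sigma>)" for w
    using cycle_words_subset [OF that] by (intro filter_True) blast
  then have "map (filter (\<lambda>x. x \<in> {1..n})) (cycle_words n \<sigma>) = cycle_words n \<sigma>"
    by (rule map_idI)
  then show ?case
    by (simp add: word_restriction_def words_perm_cycle_words)
next
  case (Suc k)
  let ?ws = "map (filter (\<lambda>x. x \<in> {k..n})) (cycle_words n \<sigma>)"
  have "map (filter (\<lambda>x. x \<in> {Suc k..n})) (cycle_words n \<sigma>) = map (filter (\<lambda>x. x \<noteq> k)) ?ws"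
    by (auto intro!: filter_cong)
  moreover have "distinct (concat ?ws)"
    by (intro distinct_concat_map_filter distinct_cycle_words)
  ultimately have "word_restriction n \<sigma> {Suc k..n} = del_point k (word_restriction n \<sigma> {k..n})"
    unfolding word_restriction_def using words_perm_delete by metis
  then show ?case
    using Suc by simp
qed

text \<open>In the word of the cycle of g only the letters that are at least g survive; g is fixed
  iff it is the only survivor, that is, iff no letter of its cycle exceeds it.\<close>

lemma word_restriction_fixed_iff:
  assumes "g \<in> {1..n}"
  shows "word_restriction n \<sigma> {g..n} g = g \<longleftrightarrow> g \<in> max_elements n \<sigma>"
proof -
  let ?f = "filter (\<lambda>x. x \<in> {g..n})"
  have *: "word_restriction n \<sigma> {g..n} g = g \<longleftrightarrow> Max (set w) = g"
    if w: "w \<in> set (cycle_words n \<sigma>)" "g \<in> set w" for w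
  proof -
    have dist: "distinct (concat (map ?f (cycle_words n \<sigma>)))"
      by (intro distinct_concat_map_filter distinct_cycle_words)
    have gf: "g \<in> set (?f w)" and "distinct w"
      using w assms distinct_cycle_words by (auto simp: distinct_concat_iff)
    then have "word_restriction n \<sigma> {g..n} g = g \<longleftrightarrow> ?f w = [g]"
      unfolding word_restriction_def
      using words_perm_inside [OF dist _ gf] w(1) cycle_of_list_fixed_iff [of "?f w" g] by auto
    also have "\<dots> \<longleftrightarrow> set (?f w) = {g}"
      using \<open>distinct w\<close> by (intro singleton_list_iff) simp
    also have "\<dots> \<longleftrightarrow> (\<forall>x\<in>set w. x \<le> g)"
    proof -
      have "set w \<subseteq> {1..n}"
        by (rule cycle_words_subset [OF w(1)])
      then show ?thesis
        using gf by fastforce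
    qed
    also have "\<dots> \<longleftrightarrow> Max (set w) = g"
      using w(2) by (metis List.finite_set Max_eqI Max_ge)
    finally show ?thesis .
  qed
  obtain v where v: "v \<in> set (cycle_words n \<sigma>)" "g \<in> set v"
    using assms by (rule cycle_words_cover)
  have "g \<in> max_elements n \<sigma>" if "word_restriction n \<sigma> {g..n} g = g"
    using * [OF v] that v(1) unfolding max_elements_def by blast
  moreover have "word_restriction n \<sigma> {g..n} g = g" if max: "g \<in> max_elements n \<sigma>"
  proof -
    obtain w where w: "w \<in> set (cycle_words n \<sigma>)" "g = Max (set w)"
      using max unfolding max_elements_def by blast
    then obtain h where "w = cycle_word \<sigma> h"
      unfolding set_cycle_words by blast
    \<comment> \<open>The word is nonempty, so its \<open>Max\<close> is one of its letters.\<close>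
    then have "h \<in> set w"
      by (simp add: cycle_word_refl [OF permutation_cycle_words])
    then have "g \<in> set w"
      unfolding w(2) by (intro Max_in) auto
    then show ?thesis
      using * w by simp
  qed
  ultimately show ?thesis
    by blast
qed

end


section \<open>Operators on tensor powers\<close>

lemma op_prod_simps [simp]:
  "op_prod n N [] = op_one n N" "op_prod n N (X # Xs) = op_mult n N X (op_prod n N Xs)"
  by (simp_all add: op_prod_def)

lemma op_mult_assoc:
  "op_mult n N (op_mult n N X Y) Z = op_mult n N X (op_mult n N Y Z)"
proof (intro ext)
  fix a b
  show "op_mult n N (op_mult n N X Y) Z a b = op_mult n N X (op_mult n N Y Z) a b"
    unfolding op_mult_def sum_distrib_left sum_distrib_right
    by (subst sum.swap) (simp add: mult.assoc)
qed

lemma perm_op_id: "perm_op n N id = op_one n N"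
proof (intro ext)
  fix a b
  have "a = b" if "a \<in> multi_idx n N" "b \<in> multi_idx n N" "\<forall>i\<in>{1..N}. a i = b i"
    using that unfolding multi_idx_def by (auto intro: PiE_ext)
  then show "perm_op n N id a b = op_one n N a b"
    by (auto simp: perm_op_def op_one_def)
qed

lemma op_mult_one_left:
  "op_mult n N (op_one n N) Y a b = (if a \<in> multi_idx n N then Y a b else 0)"
  using op_mult_diag [of n N "\<lambda>_. 1" Y a b] by (simp add: op_one_def)

text \<open>\<open>op_one\<close> kills entries outside the multi-indices, so it is not neutral on
  arbitrary functions; inside a product the summation index is a multi-index anyway.\<close>

lemma op_mult_one_middle:
  "op_mult n N X (op_mult n N (op_one n N) Y) = op_mult n N X Y"
proof (intro ext)
  fix a b
  show "op_mult n N X (op_mult n N (op_one n N) Y) a b = op_mult n N X Y a b"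
    unfolding op_mult_def [of n N X] by (intro sum.cong) (simp_all add: op_mult_one_left)
qed

text \<open>The scalars have to move past the entries of X, hence the assumption that they are
  central.\<close>

lemma op_mult_sum_right:
  assumes "\<And>i x. c i * x = x * c i"
  shows "op_mult n N X (\<lambda>a b. \<Sum>i\<in>A. c i * Y i a b) = (\<lambda>a b. \<Sum>i\<in>A. c i * op_mult n N X (Y i) a b)"
proof (intro ext)
  fix a b
  have "x * (c i * y) = c i * (x * y)" for x y i
    using assms by (metis mult.assoc)
  then show "op_mult n N X (\<lambda>a b. \<Sum>i\<in>A. c i * Y i a b) a b = (\<Sum>i\<in>A. c i * op_mult n N X (Y i) a b)"
    unfolding op_mult_def sum_distrib_left by (subst sum.swap) simp
qed

lemma op_mult_sum_left:
  "op_mult n N (\<lambda>a b. \<Sum>i\<in>A. c i * X i a b) Y = (\<lambda>a b. \<Sum>i\<in>A. c i * op_mult n N (X i) Y a b)"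
proof (intro ext)
  fix a b
  show "op_mult n N (\<lambda>a b. \<Sum>i\<in>A. c i * X i a b) Y a b = (\<Sum>i\<in>A. c i * op_mult n N (X i) Y a b)"
    unfolding op_mult_def sum_distrib_left sum_distrib_right
    by (subst sum.swap) (simp add: mult.assoc)
qed

text \<open>For a multi-index a, this is the only column in which row a of
  \<open>perm_op n N \<rho>\<close> is nonzero. The restriction keeps it undefined outside
  \<open>{1..N}\<close>, as multi-indices are.\<close>

definition permute_idx :: "nat \<Rightarrow> (nat \<Rightarrow> nat) \<Rightarrow> (nat \<Rightarrow> nat) \<Rightarrow> nat \<Rightarrow> nat"
  where "permute_idx N \<rho> a = restrict (a \<circ> \<rho>) {1..N}"

lemma permute_idx_in:
  assumes "\<rho> permutes {1..N}" "a \<in> multi_idx n N"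
  shows "permute_idx N \<rho> a \<in> multi_idx n N"
  using assms(2) permutes_in_image [OF assms(1)] unfolding permute_idx_def multi_idx_def restrict_PiE_iff comp_apply
  by (blast intro: PiE_mem)

text \<open>The condition in \<open>perm_op\<close> is solved for the column and for the row, so
  that multiplication by \<open>perm_op\<close> on either side leaves a sum with one term.\<close>

lemma perm_op_eq_iff:
  assumes "\<rho> permutes {1..N}" "a \<in> multi_idx n N" "b \<in> multi_idx n N"
  shows "(\<forall>i\<in>{1..N}. a (\<rho> i) = b i) \<longleftrightarrow> b = permute_idx N \<rho> a"
    and "(\<forall>i\<in>{1..N}. a (\<rho> i) = b i) \<longleftrightarrow> a = permute_idx N (inv \<rho>) b"
proof -
  have eq: "c = permute_idx N \<pi> d \<longleftrightarrow> (\<forall>i\<in>{1..N}. c i = d (\<pi> i))"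
    if "c \<in> multi_idx n N" "d \<in> multi_idx n N" "\<pi> permutes {1..N}" for c d \<pi>
  proof
    show "c = permute_idx N \<pi> d" if "\<forall>i\<in>{1..N}. c i = d (\<pi> i)"
    proof (rule PiE_ext)
      show "c \<in> {1..N} \<rightarrow>\<^sub>E {1..n}" "permute_idx N \<pi> d \<in> {1..N} \<rightarrow>\<^sub>E {1..n}"
        using \<open>c \<in> multi_idx n N\<close> permute_idx_in [OF \<open>\<pi> permutes {1..N}\<close> \<open>d \<in> multi_idx n N\<close>]
        unfolding multi_idx_def .
    qed (use that in \<open>simp add: permute_idx_def\<close>)
  qed (simp add: permute_idx_def)
  show "(\<forall>i\<in>{1..N}. a (\<rho> i) = b i) \<longleftrightarrow> b = permute_idx N \<rho> a"
    using eq [of b a \<rho>] assms by auto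
  \<comment> \<open>The quantifier on the right is reindexed by \<rho>.\<close>
  have "(\<forall>i\<in>{1..N}. a (\<rho> i) = b i) \<longleftrightarrow> (\<forall>i\<in>{1..N}. a i = b (inv \<rho> i))"
    by (subst (2) permutes_image [OF assms(1), symmetric]) (simp add: permutes_inverses [OF assms(1)])
  then show "(\<forall>i\<in>{1..N}. a (\<rho> i) = b i) \<longleftrightarrow> a = permute_idx N (inv \<rho>) b"
    using eq [of a b "inv \<rho>"] assms permutes_inv by auto
qed

lemma op_mult_perm_left:
  assumes "\<rho> permutes {1..N}"
  shows "op_mult n N (perm_op n N \<rho>) Y a b = (if a \<in> multi_idx n N then Y (permute_idx N \<rho> a) b else 0)"
proof -
  have "op_mult n N (perm_op n N \<rho>) Y a b
      = (\<Sum>c\<in>multi_idx n N. if c = permute_idx N \<rho> a then (if a \<in> multi_idx n N then Y c b else 0) else 0)"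
    unfolding op_mult_def by (intro sum.cong) (use perm_op_eq_iff(1) [OF assms] in \<open>auto simp: perm_op_def\<close>)
  then show ?thesis
    using permute_idx_in [OF assms] by auto
qed

lemma op_mult_perm_right:
  assumes "\<rho> permutes {1..N}"
  shows "op_mult n N Y (perm_op n N \<rho>) a b
    = (if b \<in> multi_idx n N then Y a (permute_idx N (inv \<rho>) b) else 0)"
proof -
  have "op_mult n N Y (perm_op n N \<rho>) a b
      = (\<Sum>c\<in>multi_idx n N. if c = permute_idx N (inv \<rho>) b then (if b \<in> multi_idx n N then Y a c else 0) else 0)"
    unfolding op_mult_def by (intro sum.cong) (use perm_op_eq_iff(2) [OF assms] in \<open>auto simp: perm_op_def\<close>)
  then show ?thesis
    using permute_idx_in [OF permutes_inv [OF assms]] by auto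
qed

text \<open>The operator of \<rho> puts factor \<open>inv \<rho> s\<close> into position s, so X
  acting at s afterwards is X acting on that factor before. Moving a permutation to the left of a
  leg thus renames the leg.\<close>

lemma leg_perm_op:
  assumes \<rho>: "\<rho> permutes {1..N}" and s: "s \<in> {1..N}"
  shows "op_mult n N (leg n N s X) (perm_op n N \<rho>) = op_mult n N (perm_op n N \<rho>) (leg n N (inv \<rho> s) X)"
proof (intro ext)
  fix a b
  note inverses = permutes_inverses [OF \<rho>]
  have s': "inv \<rho> s \<in> {1..N}"
    using s permutes_in_image [OF permutes_inv [OF \<rho>]] by blast
  have "(\<forall>t\<in>{1..N} - {s}. a t = permute_idx N (inv \<rho>) b t)
      \<longleftrightarrow> (\<forall>t\<in>{1..N} - {s}. a t = b (inv \<rho> t))"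
    by (auto simp: permute_idx_def)
  also have "\<dots> \<longleftrightarrow> (\<forall>t\<in>{1..N} - {inv \<rho> s}. a (\<rho> t) = b t)"
  proof -
    have "{1..N} - {s} = \<rho> ` ({1..N} - {inv \<rho> s})"
      by (simp add: image_set_diff permutes_inj [OF \<rho>] permutes_image [OF \<rho>] inverses del: One_nat_def)
    then show ?thesis
      by (simp add: inverses)
  qed
  also have "\<dots> \<longleftrightarrow> (\<forall>t\<in>{1..N} - {inv \<rho> s}. permute_idx N \<rho> a t = b t)"
    by (auto simp: permute_idx_def)
  finally show "op_mult n N (leg n N s X) (perm_op n N \<rho>) a b = op_mult n N (perm_op n N \<rho>) (leg n N (inv \<rho> s) X) a b"
    unfolding op_mult_perm_left [OF \<rho>] op_mult_perm_right [OF \<rho>] leg_def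
    using permute_idx_in [OF \<rho>] permute_idx_in [OF permutes_inv [OF \<rho>]] s s'
    by (auto simp: permute_idx_def inverses)
qed


section \<open>Expansion of the ordered product\<close>

text \<open>For k = 1 and \<sigma> a permutation of \<open>{1..N}\<close>, the fold is the word
  restriction to \<open>{g..N}\<close>, so the factors \<open>\<alpha> g\<close> are those of the g
  that are not maximal in their cycles. The lower end k varies for the sake of induction.\<close>

definition cycle_weight :: "nat \<Rightarrow> nat \<Rightarrow> (nat \<Rightarrow> 'c::comm_monoid_mult) \<Rightarrow> (nat \<Rightarrow> nat) \<Rightarrow> 'c"
  where "cycle_weight k N \<alpha> \<sigma> = (\<Prod>g\<in>{k..N}. if fold del_point [k..<g] \<sigma> g = g then 1 else \<alpha> g)"

lemma fold_del_point_Suc: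
  "k < j \<Longrightarrow> fold del_point [k..<j] \<sigma> = fold del_point [Suc k..<j] (del_point k \<sigma>)"
  by (simp add: upt_conv_Cons)

lemma cycle_weight_Suc:
  assumes "k \<le> N"
  shows "cycle_weight k N \<alpha> \<sigma> = (if \<sigma> k = k then 1 else \<alpha> k) * cycle_weight (Suc k) N \<alpha> (del_point k \<sigma>)"
  unfolding cycle_weight_def using assms
  by (subst atLeastAtMost_insertL [symmetric]) (auto simp: fold_del_point_Suc intro!: prod.cong)

text \<open>Downward induction on k, attaching one leg and one factor on the left at a time. The sum
  runs over \<rho>, the permutation whose operator collects on the left, while weights and legs are
  read off from \<open>inv \<rho>\<close>. The map \<phi> embeds commuting scalars
  centrally.\<close>

lemma ordered_product_expansion:
  fixes X :: "nat \<Rightarrow> nat \<Rightarrow> nat \<Rightarrow> 'a::ring_1" and \<phi> :: "'c::comm_monoid_mult \<Rightarrow> 'a"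
  assumes \<phi>: "\<phi> 1 = 1" "\<And>x y. \<phi> (x * y) = \<phi> x * \<phi> y" "\<And>c x. \<phi> c * x = x * \<phi> c"
    and k: "1 \<le> k" "k \<le> Suc N"
  shows "op_prod n N (concat (map (\<lambda>j. leg n N j (X j) #
        (if j < N then [\<lambda>a b. op_one n N a b + \<phi> (\<alpha> j) * (\<Sum>i\<in>{j+1..N}. swap_op n N j i a b)] else []))
        [k..<Suc N]))
    = (\<lambda>a b. \<Sum>\<rho> | \<rho> permutes {k..N}. \<phi> (cycle_weight k N \<alpha> (inv \<rho>)) *
        op_prod n N (perm_op n N \<rho> # map (\<lambda>j. leg n N (fold del_point [k..<j] (inv \<rho>) j) (X j)) [k..<Suc N]) a b)"
    (is "?L k = ?R k")
  using k(2,1)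
proof (induction k rule: inc_induct)
  case base
  \<comment> \<open>For k = Suc N both products of legs are empty; on the right the identity
    permutation contributes one more \<open>op_one\<close>.\<close>
  have "op_mult n N (op_one n N) (op_one n N) = (op_one n N :: 'a tensor_op)"
    by (intro ext) (simp only: op_mult_one_left, auto simp: op_one_def)
  then show ?case
    by (simp add: cycle_weight_def \<phi> perm_op_id [unfolded id_def])
next
  case (step k)
  then have k: "1 \<le> k" "k \<le> N"
    by auto
  define T :: "nat \<Rightarrow> 'a tensor_op" where "T i = swap_op n N k i" for i
  \<comment> \<open>The value i = k stands for the summand 1: \<open>T k\<close> is the identity,
    with weight 1. The whole factor then is one sum over \<open>{k..N}\<close>.\<close>
  define e where "e i = (if i = k then 1 else \<alpha> k)" for i
  define P where "P = (\<lambda>a b. \<Sum>i\<in>{k..N}. \<phi> (e i) * T i a b)"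
  define W where "W \<tau> = op_prod n N (map (\<lambda>j. leg n N (fold del_point [Suc k..<j] \<tau> j) (X j)) [Suc k..<Suc N])" for \<tau>
  define w where "w \<tau> = cycle_weight (Suc k) N \<alpha> \<tau>" for \<tau>
  have IH: "?L (Suc k) = (\<lambda>a b. \<Sum>\<rho> | \<rho> permutes {Suc k..N}. \<phi> (w (inv \<rho>)) * op_mult n N (perm_op n N \<rho>) (W (inv \<rho>)) a b)"
    using step unfolding W_def w_def by simp
  have T_k: "T k = op_one n N"
    by (simp add: T_def perm_op_id)
  have P: "P = (\<lambda>a b. op_one n N a b + \<phi> (\<alpha> k) * (\<Sum>i\<in>{k+1..N}. swap_op n N k i a b))"
  proof (intro ext)
    fix a b
    have "(\<Sum>i\<in>{Suc k..N}. \<phi> (e i) * T i a b) = (\<Sum>i\<in>{Suc k..N}. \<phi> (\<alpha> k) * T i a b)"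
      by (intro sum.cong) (auto simp: e_def)
    then show "P a b = op_one n N a b + \<phi> (\<alpha> k) * (\<Sum>i\<in>{k+1..N}. swap_op n N k i a b)"
      unfolding P_def sum.atLeast_Suc_atMost [OF k(2)]
      by (simp add: e_def \<phi> sum_distrib_left T_def perm_op_id)
  qed
  have "?L k = op_mult n N (leg n N k (X k)) (op_mult n N P (?L (Suc k)))"
  proof (cases "k < N")
    case True
    then show ?thesis
      using k by (simp add: upt_conv_Cons P del: upt_Suc)
  next
    \<comment> \<open>For k = N the list has no factor after the leg, but the sum in P is empty and
      P is the identity.\<close>
    case False
    then have "P = op_one n N"
      using k by (simp add: P)
    then show ?thesis
      using k False by (simp add: upt_conv_Cons op_mult_one_middle del: upt_Suc)
  qed
  also have "\<dots> = (\<lambda>a b. \<Sum>i\<in>{k..N}. \<phi> (e i) * (\<Sum>\<rho> | \<rho> permutes {Suc k..N}. \<phi> (w (inv \<rho>)) *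
      op_mult n N (leg n N k (X k)) (op_mult n N (T i) (op_mult n N (perm_op n N \<rho>) (W (inv \<rho>)))) a b))"
    unfolding IH P_def by (simp only: op_mult_sum_left op_mult_sum_right [where c = "\<lambda>i. \<phi> (g i)" for g, OF \<phi>(3)])
  also have "\<dots> = ?R k"
  proof (intro ext)
    fix a b
    define f where "f \<rho> = \<phi> (cycle_weight k N \<alpha> (inv \<rho>)) *
        op_prod n N (perm_op n N \<rho> # map (\<lambda>j. leg n N (fold del_point [k..<j] (inv \<rho>) j) (X j)) [k..<Suc N]) a b" for \<rho>
    have "f (transpose k i \<circ> \<rho>) = \<phi> (e i) * (\<phi> (w (inv \<rho>)) *
        op_mult n N (leg n N k (X k)) (op_mult n N (T i) (op_mult n N (perm_op n N \<rho>) (W (inv \<rho>)))) a b)"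
      if i: "i \<in> {k..N}" and \<rho>: "\<rho> permutes {Suc k..N}" for i \<rho>
    proof -
      define \<pi> where "\<pi> = transpose k i \<circ> \<rho>"
      have T_permutes: "transpose k i permutes {1..N}"
        using i k by (intro permutes_swap_id) auto
      have \<rho>_permutes: "\<rho> permutes {1..N}"
        using \<rho> by (rule permutes_subset) auto
      have \<pi>_permutes: "\<pi> permutes {1..N}"
        unfolding \<pi>_def by (rule permutes_compose [OF \<rho>_permutes T_permutes])
      have bij: "bij (inv \<rho>)"
        using permutes_bij [OF permutes_inv [OF \<rho>]] .
      have fix_k: "inv \<rho> k = k"
        using permutes_not_in [OF permutes_inv [OF \<rho>]] by simp
      \<comment> \<open>Inversion turns the left factor \<open>transpose k i\<close> into a right
        one, which the deletion of k removes.\<close>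
      have inv_\<pi>: "inv \<pi> = inv \<rho> \<circ> transpose k i"
        unfolding \<pi>_def using permutes_bij [OF \<rho>] by (simp add: o_inv_distrib)
      have del: "del_point k (inv \<pi>) = inv \<rho>"
        unfolding inv_\<pi> using bij fix_k by (rule del_point_comp_transpose)
      \<comment> \<open>Here \<open>inv \<pi> k\<close> equals \<open>inv \<rho> i\<close>, and
        \<open>inv \<rho>\<close> takes the value k only at k; so the weight of k is 1 exactly for
        the summand 1.\<close>
      have "inv \<pi> k = k \<longleftrightarrow> i = k"
        unfolding inv_\<pi> using bij fix_k by (metis bij_pointE comp_apply transpose_apply_first)
      then have weight: "cycle_weight k N \<alpha> (inv \<pi>) = e i * w (inv \<rho>)"
        unfolding cycle_weight_Suc [OF k(2)] del w_def e_def by simp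
      have upt: "[k..<Suc N] = k # [Suc k..<Suc N]"
        using k by (simp add: upt_conv_Cons del: upt_Suc)
      have legs: "map (\<lambda>j. leg n N (fold del_point [k..<j] (inv \<pi>) j) (X j)) [Suc k..<Suc N]
          = map (\<lambda>j. leg n N (fold del_point [Suc k..<j] (inv \<rho>) j) (X j)) [Suc k..<Suc N]"
        by (intro map_cong refl) (auto simp: fold_del_point_Suc del)
      have "op_prod n N (map (\<lambda>j. leg n N (fold del_point [k..<j] (inv \<pi>) j) (X j)) [k..<Suc N])
          = op_mult n N (leg n N (inv \<pi> k) (X k)) (W (inv \<rho>))"
        unfolding upt list.map legs op_prod_simps W_def by simp
      \<comment> \<open>Moving the first leg operator to the left of \<pi> turns its leg
        \<open>inv \<pi> k\<close> back into k.\<close>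
      then have "op_prod n N (perm_op n N \<pi> # map (\<lambda>j. leg n N (fold del_point [k..<j] (inv \<pi>) j) (X j)) [k..<Suc N])
          = op_mult n N (op_mult n N (leg n N k (X k)) (perm_op n N \<pi>)) (W (inv \<rho>))"
        using leg_perm_op [OF \<pi>_permutes, of k n "X k"] k by (simp add: op_mult_assoc)
      also have "\<dots> = op_mult n N (leg n N k (X k)) (op_mult n N (T i) (op_mult n N (perm_op n N \<rho>) (W (inv \<rho>))))"
        unfolding \<pi>_def T_def perm_op_comp [OF T_permutes \<rho>_permutes, symmetric] op_mult_assoc ..
      finally show ?thesis
        unfolding f_def \<pi>_def [symmetric] weight \<phi>(2) by (simp only: mult.assoc)
    qed
    then have "(\<Sum>i\<in>{k..N}. \<phi> (e i) * (\<Sum>\<rho> | \<rho> permutes {Suc k..N}. \<phi> (w (inv \<rho>)) *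
          op_mult n N (leg n N k (X k)) (op_mult n N (T i) (op_mult n N (perm_op n N \<rho>) (W (inv \<rho>)))) a b))
        = (\<Sum>i\<in>{k..N}. \<Sum>\<rho> | \<rho> permutes {Suc k..N}. f (transpose k i \<circ> \<rho>))"
      unfolding sum_distrib_left by (intro sum.cong refl) simp
    \<comment> \<open>A permutation of \<open>{k..N}\<close> is
      \<open>transpose k i \<circ> \<rho>\<close> for exactly one pair, with i the image of
      k.\<close>
    also have "\<dots> = sum f {\<rho>. \<rho> permutes {k..N}}"
      using sum_over_permutations_insert [of "{Suc k..N}" k f] atLeastAtMost_insertL [OF k(2)] by simp
    finally show "(\<Sum>i\<in>{k..N}. \<phi> (e i) * (\<Sum>\<rho> | \<rho> permutes {Suc k..N}. \<phi> (w (inv \<rho>)) *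
          op_mult n N (leg n N k (X k)) (op_mult n N (T i) (op_mult n N (perm_op n N \<rho>) (W (inv \<rho>)))) a b))
        = ?R k a b"
      unfolding f_def .
  qed
  finally show ?case .
qed


section \<open>Central scalars\<close>

lemma alg_const_uminus: "alg_const (- c) = - alg_const c"
  using alg_const_hom(3) [of c "- c"] by (simp add: alg_const_hom(1) eq_neg_iff_add_eq_0 add.commute)

lemma alg_const_sum: "alg_const (sum f A) = (\<Sum>i\<in>A. alg_const (f i))"
  by (induction A rule: infinite_finite_induct) (simp_all add: alg_const_hom)

lemma series_const_1: "series_const 1 = 1"
  by (rule fps_ext) (simp add: series_const_def alg_const_hom)

lemma series_const_mult: "series_const (f * g) = series_const f * series_const g"
  by (rule fps_ext) (simp add: series_const_def fps_mult_nth alg_const_sum alg_const_hom)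

lemma series_const_uminus: "series_const (- f) = - series_const f"
  by (rule fps_ext) (simp add: series_const_def alg_const_uminus)

text \<open>Centrality holds coefficientwise. With \<open>series_const_1\<close> and
  \<open>series_const_mult\<close> it makes \<open>series_const\<close> a possible \<phi> in the
  expansion.\<close>

lemma series_const_central: "series_const f * x = x * series_const f"
proof (rule fps_ext)
  fix r
  show "(series_const f * x) $ r = (x * series_const f) $ r"
    unfolding fps_mult_nth
    by (rule sum.reindex_bij_witness [of _ "\<lambda>i. r - i" "\<lambda>i. r - i"])
       (auto simp: series_const_def alg_const_central)
qed

text \<open>Absorbs the minus sign of \<open>Pi_op\<close>: -1/(2u - k - n + 2) = 1/(n - 2u - 2 +
  k), the factor in \<open>alpha_bar\<close>.\<close>

lemma recip_linear_uminus: "- recip_linear a c = recip_linear (- a) (- c)"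
proof -
  have "fps_const (- a) + fps_const (- c) * fps_X = - (fps_const a + fps_const c * fps_X)"
    by (simp flip: fps_const_neg)
  then show ?thesis
    by (simp only: recip_linear_def fps_inverse_minus mult_minus_right)
qed

text \<open>The factors set to 1 in the weight are those at the fixed points of word restrictions,
  which are the cycle maxima.\<close>

lemma alpha_bar_eq_cycle_weight:
  assumes "\<sigma> permutes {1..n}"
  shows "alpha_bar n \<sigma> = cycle_weight 1 n (\<lambda>g. recip_linear (- 2) (of_nat n - 2 + of_nat g)) \<sigma>"
proof -
  let ?\<alpha> = "\<lambda>g. recip_linear (- 2) (of_nat n - 2 + of_nat g)"
  have "cycle_weight 1 n ?\<alpha> \<sigma> = (\<Prod>g\<in>{1..n}. if g \<in> max_elements n \<sigma> then 1 else ?\<alpha> g)"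
    unfolding cycle_weight_def
    using word_restriction_fixed_iff [OF assms] word_restriction_eq_fold [OF assms]
    by (intro prod.cong) auto
  also have "\<dots> = (\<Prod>g\<in>{1..n} - max_elements n \<sigma>. ?\<alpha> g)"
    by (rule prod.mono_neutral_cong_right) auto
  finally show ?thesis
    by (simp add: alpha_bar_def)
qed

section \<open>Expansion of the bracket over the symmetric group\<close>

theorem proposition5:
  fixes n :: nat
  assumes "n = LENGTH('m::len0) + LENGTH('l::len0)"
  shows "(bracket_B :: ('m, 'l) reflection_algebra fps tensor_op) =
    (\<lambda>a b. \<Sum>\<sigma> | \<sigma> permutes {1..n}.
      series_const (alpha_bar n \<sigma>) *
      op_prod n n (perm_op n n (inv \<sigma>) #
        map (\<lambda>k. B_leg (word_restriction n \<sigma> {k..n} k) (k - 1)) [1..<Suc n]) a b)"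
proof -
  define X :: "nat \<Rightarrow> nat \<Rightarrow> nat \<Rightarrow> ('m, 'l) reflection_algebra fps"
    where "X j = (\<lambda>p q. shift_series (of_nat (j - 1)) (b_series p q))" for j
  define \<alpha> :: "nat \<Rightarrow> complex fps" where "\<alpha> g = recip_linear (- 2) (of_nat n - 2 + of_nat g)" for g
  \<comment> \<open>The shift belongs to the position j in the product and stays in place when the
    leg s is renamed.\<close>
  have B_leg: "(B_leg s (j - 1) :: ('m, 'l) reflection_algebra fps tensor_op) = leg n n s (X j)" for s j
    by (simp add: B_leg_def X_def assms Let_def)
  have Pi_op: "(Pi_op k :: ('m, 'l) reflection_algebra fps tensor_op)
      = (\<lambda>a b. op_one n n a b + series_const (\<alpha> k) * (\<Sum>i\<in>{k+1..n}. swap_op n n k i a b))" for k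
  proof -
    have "\<alpha> k = - recip_linear 2 (- of_nat k - of_nat n + 2)"
      unfolding recip_linear_uminus \<alpha>_def by (simp add: algebra_simps)
    then show ?thesis
      unfolding Pi_op_def Let_def assms [symmetric] by (simp add: series_const_uminus)
  qed
  have "(bracket_B :: ('m, 'l) reflection_algebra fps tensor_op) =
      op_prod n n (concat (map (\<lambda>j. leg n n j (X j) #
        (if j < n then [\<lambda>a b. op_one n n a b + series_const (\<alpha> j) * (\<Sum>i\<in>{j+1..n}. swap_op n n j i a b)] else []))
        [1..<Suc n]))"
    unfolding bracket_B_def Let_def assms [symmetric] B_leg Pi_op ..
  also have "\<dots> = (\<lambda>a b. \<Sum>\<rho> | \<rho> permutes {1..n}. series_const (cycle_weight 1 n \<alpha> (inv \<rho>)) *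
      op_prod n n (perm_op n n \<rho> # map (\<lambda>j. leg n n (fold del_point [1..<j] (inv \<rho>) j) (X j)) [1..<Suc n]) a b)"
    by (rule ordered_product_expansion [where \<phi> = series_const,
          OF series_const_1 series_const_mult series_const_central]) simp_all
  \<comment> \<open>Substitution of \<open>inv \<sigma>\<close> for \<rho>.\<close>
  also have "\<dots> = (\<lambda>a b. \<Sum>\<sigma> | \<sigma> permutes {1..n}. series_const (cycle_weight 1 n \<alpha> \<sigma>) *
      op_prod n n (perm_op n n (inv \<sigma>) # map (\<lambda>j. leg n n (fold del_point [1..<j] \<sigma> j) (X j)) [1..<Suc n]) a b)"
    by (subst sum_permutations_inverse, intro ext sum.cong refl) (simp only: mem_Collect_eq permutes_inv_inv)
  also have "\<dots> = (\<lambda>a b. \<Sum>\<sigma> | \<sigma> permutes {1..n}. series_const (alpha_bar n \<sigma>) *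
      op_prod n n (perm_op n n (inv \<sigma>) #
        map (\<lambda>k. B_leg (word_restriction n \<sigma> {k..n} k) (k - 1)) [1..<Suc n]) a b)"
  proof (intro ext sum.cong refl, unfold mem_Collect_eq)
    fix a b and \<sigma> :: "nat \<Rightarrow> nat" assume \<sigma>: "\<sigma> permutes {1..n}"
    have "map (\<lambda>j. leg n n (fold del_point [1..<j] \<sigma> j) (X j)) [1..<Suc n]
        = map (\<lambda>k. B_leg (word_restriction n \<sigma> {k..n} k) (k - 1)) [1..<Suc n]"
      by (intro map_cong refl) (simp only: B_leg word_restriction_eq_fold [OF \<sigma>] set_upt atLeastLessThan_iff)
    then show "series_const (cycle_weight 1 n \<alpha> \<sigma>) *
      op_prod n n (perm_op n n (inv \<sigma>) # map (\<lambda>j. leg n n (fold del_point [1..<j] \<sigma> j) (X j)) [1..<Suc n]) a b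
      = series_const (alpha_bar n \<sigma>) * op_prod n n (perm_op n n (inv \<sigma>) #
        map (\<lambda>k. B_leg (word_restriction n \<sigma> {k..n} k) (k - 1)) [1..<Suc n]) a b"
      unfolding alpha_bar_eq_cycle_weight [OF \<sigma>] \<alpha>_def by (simp only:)
  qed
  finally show ?thesis .
qed

end
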